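(* Consider the joint model (M1)--(M3), the two-step estimators, the iterated forecasts $\hat y_{T+h}$, the variance estimator $\hat\sigma_e^2$ and the Box--Jenkins interval $\mathrm{PI}^{BJ}(\hat y_{T+h})$ described in the context, with $\alpha\in(0,1)$. Assume: (i) models (M1) and (M2) are both for stationary processes (which ensures that $y_t=O_p(1)$ and $\|\mathbf y_t^S\|=O_p(1)$ for each $t=1,\dots,T$), and the estimation procedures (E1) and (E2) are $\zeta_T$-consistent; (ii) $\max_{t=1,\dots,T}\mathbb E(y_t^4)=O(1)$ and $\max_{t=1,\dots,T}\mathbb E(\|\mathbf y_t^S\|^4)=O(1)$; (iii) $\lambda_{\max,z}=o_p(\zeta_T^2)$, $\lambda_{\max,x}=o_p(\zeta_T^2)$ and $\lambda_{\max,D}=o_p(\zeta_T^2)$, where, with $\lambda_{\max}(\cdot)$ the largest eigenvalue of a symmetric matrix, $\lambda_{\max,z}=\lambda_{\max}\big(\sum_{t=q_1+1}^T\mathbf z_t\mathbf z_t^\top/T\big)$, $\lambda_{\max,x}=\lambda_{\max}\big(\sum_{t=q_1+1}^T\mathbf x_t\mathbf x_t^\top/T\big)$, $\lambda_{\max,D}=\lambda_{\max}\big(\sum_{t=q_1+1}^T\mathbf D(\mathbf y_t^S)\mathbf D(\mathbf y_t^S)^\top/T\big)$. Then $\hat\sigma_e^2\overset{p}{\to}\sigma_e^2$, and for each fixed integer $h\ge1$, $$\liminf_{T\to\infty}\mathbb P\big\{y_{T+h}\in\mathrm{PI}^{BJ}(\hat y_{T+h})\big\}\ge 1-\alpha 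.$$
   Context: $q_1\ge q_2\ge 1$ (model orders) and $K,d,p$ (dimensions) are positive integers. $\|\cdot\|$ is the Euclidean norm of a vector or the spectral norm of a matrix, $\|\cdot\|_F$ the Frobenius norm. Asymptotics are as $T\to\infty$. Model. $y_t\in\mathbb R$ and $\mathbf y^S_t\in\mathbb R^K$ are time series, $\mathbf z_t\in\mathbb R^d$ and $\mathbf x_t\in\mathbb R^p$ are exogenous covariates, and (M1) $y_t=\sum_{l=1}^{q_1}\alpha_l y_{t-l}+\mathbf z_t^\top\boldsymbol\theta+\mathbf x_t^\top\boldsymbol\beta+\epsilon_t$; (M2) $\mathbf y^S_t=\sum_{l=1}^{q_2}\mathbf A^S_l\mathbf y^S_{t-l}+\mathbf B^S\mathbf x_t+\boldsymbol\epsilon^S_t$, with $\mathbf A^S_l\in\mathbb R^{K\times K}$, $\mathbf B^S\in\mathbb R^{K\times p}$; (M3) the vectors $(\epsilon_t,(\boldsymbol\epsilon_t^S)^\top)^\top$ are independent across $t$ and each is $N(\mathbf 0,\boldsymbol\Sigma)$ with $\boldsymbol\Sigma=\begin{bmatrix}\sigma_{TT}^2&\boldsymbol\Sigma_{TS}\\ \boldsymbol\Sigma_{ST}&\boldsymbol\Sigma_{SS}\end{bmatrix}$, where $\boldsymbol\Sigma_{SS}\in\mathbb R^{K\times K}$ is invertible. Derived quantities. $\boldsymbol\gamma=\boldsymbol\Sigma_{SS}^{-1}\boldsymbol\Sigma_{ST}\in\mathbb R^K$; $e_t=\epsilon_t-\boldsymbol\gamma^\top\boldsymbol\epsilon^S_t\sim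 N(0,\sigma_e^2)$ with $\sigma_e^2=\sigma_{TT}^2-\boldsymbol\Sigma_{TS}\boldsymbol\Sigma_{SS}^{-1}\boldsymbol\Sigma_{ST}$; $\boldsymbol\delta=\boldsymbol\beta-(\mathbf B^S)^\top\boldsymbol\gamma$; $\mathbf D(\mathbf y_t^S)=\mathbf y^S_t-\sum_{l=1}^{q_2}\mathbf A^S_l\mathbf y^S_{t-l}$. Then (M1) can be rewritten equivalently as $$y_t=\sum_{l=1}^{q_1}\alpha_l y_{t-l}+\mathbf z_t^\top\boldsymbol\theta+\mathbf x_t^\top\boldsymbol\delta+\boldsymbol\gamma^\top\mathbf D(\mathbf y^S_t)+e_t .$$ Estimation procedures. (E1) $(\hat{\mathbf A}^S_1,\dots,\hat{\mathbf A}^S_{q_2},\hat{\mathbf B}^S)=\arg\min\frac1T\sum_{t=q_2+1}^T\big\|\mathbf y^S_t-\sum_{l=1}^{q_2}\mathbf A^S_l\mathbf y^S_{t-l}-\mathbf B^S\mathbf x_t\big\|^2$ over $\mathbf A^S_1,\dots,\mathbf A^S_{q_2},\mathbf B^S$; set $\hat{\mathbf D}(\mathbf y_t^S)=\mathbf y^S_t-\sum_{l=1}^{q_2}\hat{\mathbf A}^S_l\mathbf y^S_{t-l}$. (E2) $(\hat{\boldsymbol\alpha},\hat{\boldsymbol\theta},\hat{\boldsymbol\delta},\hat{\boldsymbol\gamma})=\arg\min_{\boldsymbol\alpha,\boldsymbol\theta,\boldsymbol\delta,\boldsymbol\gamma}\frac1T\sum_{t=q_1+1}^T\big(y_t-\sum_{l=1}^{q_1}\alpha_l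 y_{t-l}-\mathbf z_t^\top\boldsymbol\theta-\mathbf x_t^\top\boldsymbol\delta-\boldsymbol\gamma^\top\hat{\mathbf D}(\mathbf y^S_t)\big)^2 .$ $\zeta_T$-consistency. An estimator $\hat{\mathbf B}$ of a matrix (or vector) parameter $\mathbf B$ is $\zeta_T$-consistent if $\|\hat{\mathbf B}-\mathbf B\|_F=O_p(\zeta_T^{-1})$, where $\zeta_T\to\infty$ as $T\to\infty$. The procedures (E1), (E2) being $\zeta_T$-consistent means that their outputs are $\zeta_T$-consistent for the corresponding true parameters. Forecasts. For $h\ge1$, $$\hat y_{T+h}=\sum_{l=1}^{q_1}\hat\alpha_l\hat y_{T+h-l}+\mathbf z_{T+h}^\top\hat{\boldsymbol\theta}+\mathbf x_{T+h}^\top\hat{\boldsymbol\delta}+\hat{\boldsymbol\gamma}^\top\hat{\mathbf D}(\mathbf y^S_{T+h}),$$ computed iteratively with $\hat y_t=y_t$ for $t\le T$; the quantities $\mathbf x_{T+j},\mathbf z_{T+j},\hat{\mathbf D}(\mathbf y^S_{T+j})$, $1\le j\le h$, are used as inputs. Variance estimator. $\hat\sigma_e^2=\frac1{T-q_1}\sum_{t=q_1+1}^T\hat e_t^2$ with residuals $\hat e_t=y_t-\sum_{l=1}^{q_1}\hat\alpha_l y_{t-l}-\mathbf z_t^\top\hat{\boldsymbol\theta}-\mathbf x_t^\top\hat{\boldsymbol\delta}-\hat{\boldsymbol\gamma}^\top\hat{\mathbf D}(\mathbf y^S_t)$. Box--Jenkins interval. Let $\hat{\mathbf A}\in\mathbb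 R^{q_1\times q_1}$ be the companion matrix with first row $(\hat\alpha_1,\dots,\hat\alpha_{q_1})$, entries $1$ at positions $(i+1,i)$, $1\le i\le q_1-1$, and $0$ elsewhere, $\hat{\mathbf A}^0=\mathbf I$. For the level $\alpha\in(0,1)$ (a scalar, unrelated to the coefficients $\alpha_l$), with $z_{\alpha/2}$ the $\alpha/2$ quantile of $N(0,1)$, $$\mathrm{PI}^{BJ}(\hat y_{T+h})=\Big[\hat y_{T+h}-|z_{\alpha/2}|\,\hat\sigma_e\sqrt{\textstyle\sum_{r=0}^{h-1}\big((\hat{\mathbf A}^r)_{11}\big)^2},\ \ \hat y_{T+h}+|z_{\alpha/2}|\,\hat\sigma_e\sqrt{\textstyle\sum_{r=0}^{h-1}\big((\hat{\mathbf A}^r)_{11}\big)^2}\Big],$$ where $(\mathbf M)_{11}$ is the $(1,1)$ entry of $\mathbf M$.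
   Formalization: The coverage claim (not the consistency of the variance estimator) additionally assumes σ_e² > 0 and, for each 1 ≤ j ≤ h, ‖z_{T+j}‖ = o_p(ζ_T) and ‖x_{T+j}‖ = o_p(ζ_T); it can fail without either condition. *)

theory Defs
  imports "Jordan_Normal_Form.Matrix" "HOL-Probability.Probability"
begin

(* Vectors and matrices of fixed dimension use the types of HOL-Analysis; Jordan_Normal_Form
   matrices occur only for the companion matrix, whose size is the natural number q1. *)
no_notation vec_index (infixl \<open>$\<close> 100)
no_notation scalar_prod (infix \<open>\<bullet>\<close> 70)

definition bigO_prob :: "'w measure \<Rightarrow> (nat \<Rightarrow> 'w \<Rightarrow> real) \<Rightarrow> (nat \<Rightarrow> real) \<Rightarrow> bool" where
  "bigO_prob M X r \<longleftrightarrow>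
     (\<forall>\<epsilon>>0. \<exists>C>0. \<forall>\<^sub>F T in sequentially.
        measure M {\<omega> \<in> space M. \<bar>X T \<omega>\<bar> > C * \<bar>r T\<bar>} \<le> \<epsilon>)"

definition smallo_prob :: "'w measure \<Rightarrow> (nat \<Rightarrow> 'w \<Rightarrow> real) \<Rightarrow> (nat \<Rightarrow> real) \<Rightarrow> bool" where
  "smallo_prob M X r \<longleftrightarrow>
     (\<forall>c>0. (\<lambda>T. measure M {\<omega> \<in> space M. \<bar>X T \<omega>\<bar> > c * \<bar>r T\<bar>}) \<longlonglongrightarrow> 0)"

definition tendsto_in_prob :: "'w measure \<Rightarrow> (nat \<Rightarrow> 'w \<Rightarrow> real) \<Rightarrow> real \<Rightarrow> bool" where
  "tendsto_in_prob M X c \<longleftrightarrow>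
     (\<forall>\<epsilon>>0. (\<lambda>T. measure M {\<omega> \<in> space M. \<bar>X T \<omega> - c\<bar> > \<epsilon>}) \<longlonglongrightarrow> 0)"

(* The norm of a matrix type real ^ 'n ^ 'm in HOL-Analysis is the Frobenius norm. *)
definition consistent :: "'w measure \<Rightarrow> (nat \<Rightarrow> real) \<Rightarrow>
    (nat \<Rightarrow> 'w \<Rightarrow> 'b::euclidean_space) \<Rightarrow> 'b \<Rightarrow> bool" where
  "consistent M \<zeta> b\<^sub>h b \<longleftrightarrow> bigO_prob M (\<lambda>T \<omega>. norm (b\<^sub>h T \<omega> - b)) (\<lambda>T. inverse (\<zeta> T))"

(* A coefficient vector in R^q is a function of which only the entries 1..q matter. *)
definition consistent_coeffs :: "'w measure \<Rightarrow> (nat \<Rightarrow> real) \<Rightarrow> nat \<Rightarrow>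
    (nat \<Rightarrow> 'w \<Rightarrow> nat \<Rightarrow> real) \<Rightarrow> (nat \<Rightarrow> real) \<Rightarrow> bool" where
  "consistent_coeffs M \<zeta> q a\<^sub>h a \<longleftrightarrow>
     bigO_prob M (\<lambda>T \<omega>. L2_set (\<lambda>l. a\<^sub>h T \<omega> l - a l) {1..q}) (\<lambda>T. inverse (\<zeta> T))"

(* N(m,v), with the point mass at m for v = 0. *)
definition normal_law :: "real \<Rightarrow> real \<Rightarrow> real measure" where
  "normal_law m v =
     (if v = 0 then return borel m else density lborel (normal_density m (sqrt v)))"

definition multivariate_normal ::
    "'w measure \<Rightarrow> ('w \<Rightarrow> real ^ 'n::finite) \<Rightarrow> real ^ 'n \<Rightarrow> real ^ 'n ^ 'n \<Rightarrow> bool" where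
  "multivariate_normal M X \<mu> \<Sigma> \<longleftrightarrow>
     X \<in> borel_measurable M \<and>
     Finite_Cartesian_Product.transpose \<Sigma> = \<Sigma> \<and> (\<forall>u. 0 \<le> u \<bullet> (\<Sigma> *v u)) \<and>
     (\<forall>u. distr M borel (\<lambda>\<omega>. u \<bullet> X \<omega>) = normal_law (u \<bullet> \<mu>) (u \<bullet> (\<Sigma> *v u)))"

definition block_vec :: "real \<Rightarrow> real ^ 'k::finite \<Rightarrow> real ^ (unit + 'k)" where
  "block_vec c v = (\<chi> i. case i of Inl _ \<Rightarrow> c | Inr k \<Rightarrow> v $ k)"

(* The symmetric block matrix with rows (s, u^T) and (u, S). *)
definition block_mat :: "real \<Rightarrow> real ^ 'k::finite \<Rightarrow> real ^ 'k ^ 'k \<Rightarrow>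
    real ^ (unit + 'k) ^ (unit + 'k)" where
  "block_mat s u S =
     (\<chi> i j. case i of
        Inl _ \<Rightarrow> (case j of Inl _ \<Rightarrow> s | Inr l \<Rightarrow> u $ l)
      | Inr k \<Rightarrow> (case j of Inl _ \<Rightarrow> u $ k | Inr l \<Rightarrow> S $ k $ l))"

(* Second-order stationarity; a strictly stationary process with finite second moments
   has this property. *)
definition stationary :: "'w measure \<Rightarrow> (int \<Rightarrow> 'w \<Rightarrow> 'b::euclidean_space) \<Rightarrow> bool" where
  "stationary M X \<longleftrightarrow>
     (\<forall>t. X t \<in> borel_measurable M \<and> integrable M (\<lambda>\<omega>. (norm (X t \<omega>))\<^sup>2)) \<and>
     (\<forall>s t. integral\<^sup>L M (X s) = integral\<^sup>L M (X t)) \<and>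
     (\<forall>s t k u v.
        integral\<^sup>L M (\<lambda>\<omega>. (u \<bullet> (X s \<omega> - integral\<^sup>L M (X s)))
                        * (v \<bullet> (X (s + k) \<omega> - integral\<^sup>L M (X (s + k)))))
      = integral\<^sup>L M (\<lambda>\<omega>. (u \<bullet> (X t \<omega> - integral\<^sup>L M (X t)))
                        * (v \<bullet> (X (t + k) \<omega> - integral\<^sup>L M (X (t + k))))))"

definition normal_quantile :: "real \<Rightarrow> real" where
  "normal_quantile p = Inf {c. p \<le> cdf std_normal_distribution c}"

definition lambda_max :: "real ^ 'n::finite ^ 'n \<Rightarrow> real" where
  "lambda_max S = Max {c. \<exists>v. v \<noteq> 0 \<and> S *v v = c *\<^sub>R v}"

definition outer :: "real ^ 'n::finite \<Rightarrow> real ^ 'n ^ 'n" where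
  "outer v = (\<chi> i j. v $ i * v $ j)"

definition mean_outer :: "nat \<Rightarrow> nat \<Rightarrow> (int \<Rightarrow> real ^ 'n::finite) \<Rightarrow> real ^ 'n ^ 'n" where
  "mean_outer q T v = (1 / real T) *\<^sub>R (\<Sum>t\<in>{int q + 1..int T}. outer (v t))"

definition filtered :: "nat \<Rightarrow> (nat \<Rightarrow> real ^ 'k::finite ^ 'k) \<Rightarrow>
    (int \<Rightarrow> real ^ 'k) \<Rightarrow> int \<Rightarrow> real ^ 'k" where
  "filtered q A y t = y t - (\<Sum>l=1..q. A l *v y (t - int l))"

definition loss1 :: "nat \<Rightarrow> nat \<Rightarrow> (int \<Rightarrow> real ^ 'k::finite) \<Rightarrow> (int \<Rightarrow> real ^ 'p::finite) \<Rightarrow>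
    (nat \<Rightarrow> real ^ 'k ^ 'k) \<times> (real ^ 'p ^ 'k) \<Rightarrow> real" where
  "loss1 q T y x = (\<lambda>(A, B).
     1 / real T * (\<Sum>t\<in>{int q + 1..int T}. (norm (filtered q A y t - B *v x t))\<^sup>2))"

definition residual :: "nat \<Rightarrow> (int \<Rightarrow> real) \<Rightarrow> (int \<Rightarrow> real ^ 'd::finite) \<Rightarrow>
    (int \<Rightarrow> real ^ 'p::finite) \<Rightarrow> (int \<Rightarrow> real ^ 'k::finite) \<Rightarrow>
    (nat \<Rightarrow> real) \<times> (real ^ 'd) \<times> (real ^ 'p) \<times> (real ^ 'k) \<Rightarrow> int \<Rightarrow> real" where
  "residual q y z x D = (\<lambda>(a, \<theta>, \<delta>, \<gamma>) t.
     y t - (\<Sum>l=1..q. a l * y (t - int l)) - z t \<bullet> \<theta> - x t \<bullet> \<delta> - \<gamma> \<bullet> D t)"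

definition loss2 :: "nat \<Rightarrow> nat \<Rightarrow> (int \<Rightarrow> real) \<Rightarrow> (int \<Rightarrow> real ^ 'd::finite) \<Rightarrow>
    (int \<Rightarrow> real ^ 'p::finite) \<Rightarrow> (int \<Rightarrow> real ^ 'k::finite) \<Rightarrow>
    (nat \<Rightarrow> real) \<times> (real ^ 'd) \<times> (real ^ 'p) \<times> (real ^ 'k) \<Rightarrow> real" where
  "loss2 q T y z x D b =
     1 / real T * (\<Sum>t\<in>{int q + 1..int T}. (residual q y z x D b t)\<^sup>2)"

definition variance_hat :: "nat \<Rightarrow> nat \<Rightarrow> (int \<Rightarrow> real) \<Rightarrow> (int \<Rightarrow> real ^ 'd::finite) \<Rightarrow>
    (int \<Rightarrow> real ^ 'p::finite) \<Rightarrow> (int \<Rightarrow> real ^ 'k::finite) \<Rightarrow>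
    (nat \<Rightarrow> real) \<times> (real ^ 'd) \<times> (real ^ 'p) \<times> (real ^ 'k) \<Rightarrow> real" where
  "variance_hat q T y z x D b =
     1 / (real T - real q) * (\<Sum>t\<in>{int q + 1..int T}. (residual q y z x D b t)\<^sup>2)"

function forecast :: "nat \<Rightarrow> nat \<Rightarrow> (int \<Rightarrow> real) \<Rightarrow> (int \<Rightarrow> real ^ 'd::finite) \<Rightarrow>
    (int \<Rightarrow> real ^ 'p::finite) \<Rightarrow> (int \<Rightarrow> real ^ 'k::finite) \<Rightarrow>
    (nat \<Rightarrow> real) \<times> (real ^ 'd) \<times> (real ^ 'p) \<times> (real ^ 'k) \<Rightarrow> int \<Rightarrow> real" where
  "forecast q T y z x D (a, \<theta>, \<delta>, \<gamma>) t =
     (if t \<le> int T then y t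
      else (\<Sum>l=1..q. a l * forecast q T y z x D (a, \<theta>, \<delta>, \<gamma>) (t - int l))
           + z t \<bullet> \<theta> + x t \<bullet> \<delta> + \<gamma> \<bullet> D t)"
  by auto
termination
  by (relation "Wellfounded.measure (\<lambda>(q, T, y, z, x, D, b, t). nat (t - int T))") auto

declare forecast.simps [simp del]

(* Rows and columns are numbered from 0, coefficients from 1. *)
definition companion :: "nat \<Rightarrow> (nat \<Rightarrow> real) \<Rightarrow> real Matrix.mat" where
  "companion q a = Matrix.mat q q (\<lambda>(i, j).
     if i = 0 then a (Suc j) else if i = Suc j then 1 else 0)"

definition BJ_interval ::
    "nat \<Rightarrow> (nat \<Rightarrow> real) \<Rightarrow> real \<Rightarrow> real \<Rightarrow> nat \<Rightarrow> real \<Rightarrow> real set" where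
  "BJ_interval q a \<sigma> \<alpha> h c =
     (let w = \<bar>normal_quantile (\<alpha> / 2)\<bar> * \<sigma>
                * sqrt (\<Sum>r=0..h-1. ((companion q a ^\<^sub>m r) $$ (0, 0))\<^sup>2)
      in {c - w..c + w})"

end

theory Submission
  imports Defs "HOL-Real_Asymp.Real_Asymp"
begin

text \<open>Let \<open>e\<^sub>t\<close> be the innovation of the rewritten model. The residual differs from \<open>e\<^sub>t\<close> by a sum of
  terms (estimation error) times (size of a regressor), and each of them vanishes in probability:
  the lagged series are bounded in probability and met by errors that tend to zero, while the
  covariates and \<open>D\<close> may grow like \<open>o(\<zeta>\<^sub>T)\<close>, which the rate \<open>1 / \<zeta>\<^sub>T\<close> of the estimators absorbs.
  Read in the root mean square seminorm, this and the weak law for \<open>e\<^sub>t\<^sup>2\<close> give the consistency of the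
  variance estimator. For the coverage, the forecast error is exactly
  \<open>\<Sum>r<h. \<psi>\<^sub>r\<close> times the residual at \<open>T + h - r\<close>, where \<open>\<psi>\<^sub>r\<close> is the upper left entry of the \<open>r\<close>-th power
  of the estimated companion matrix. Replacing the estimated weights and the residuals by their limits
  leaves a normal variable whose law does not depend on \<open>T\<close>, and a Slutsky argument concludes.\<close>

section \<open>Forecast recursion and largest eigenvalues\<close>

text \<open>The estimators are functions of the whole sample, so their errors are not independent of
  the regressors or of the innovations. The argument never asks for such independence: each error
  term is split into a parameter error times a regressor size, and only products of a bounded and a
  vanishing factor occur. The resulting bound is linear in the regressor sizes, which is why it
  serves twice, with root mean squares over the sample and with single norms at
  \<open>T + j\<close>. The two uses draw on different information, since the eigenvalue conditions
  control sample averages only. Comparing square roots of the two variances lets the reverse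
  triangle inequality replace the expansion of a square, whose cross terms would need a separate
  estimate. In the coverage argument the normal variable is built from the innovations after
  \<open>T\<close>, so it moves with \<open>T\<close> and does not itself converge; this is why its
  constant law has to carry the limit.\<close>

lemma companion_pow_row_Suc:
  assumes "j < q"
  shows "(companion q a ^\<^sub>m Suc m) $$ (0, j) =
    (companion q a ^\<^sub>m m) $$ (0, 0) * a (Suc j)
      + (if Suc j < q then (companion q a ^\<^sub>m m) $$ (0, Suc j) else 0)"
proof -
  let ?C = "companion q a"
  have C: "?C \<in> carrier_mat q q" by (simp add: companion_def)
  have "(?C ^\<^sub>m Suc m) $$ (0, j) =
      (\<Sum>i = 0..<q. (?C ^\<^sub>m m) $$ (0, i) * ?C $$ (i, j))"
    using C assms by (simp add: Matrix.scalar_prod_def)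
  \<comment> \<open>Column \<open>j\<close> of the companion matrix has at most two nonzero entries,
    in rows \<open>0\<close> and \<open>Suc j\<close>. Hence the first row of the powers obeys a
    recursion in which the other rows never appear.\<close>
  also have "\<dots> = (\<Sum>i = 0..<q. (if i = 0 then (?C ^\<^sub>m m) $$ (0, 0) * a (Suc j) else 0)
      + (if i = Suc j then (?C ^\<^sub>m m) $$ (0, Suc j) else 0))"
    using assms by (intro sum.cong) (auto simp: companion_def)
  also have "\<dots> = (?C ^\<^sub>m m) $$ (0, 0) * a (Suc j)
      + (if Suc j < q then (?C ^\<^sub>m m) $$ (0, Suc j) else 0)"
    unfolding sum.distrib using assms by simp
  finally show ?thesis .
qed

lemma companion_pow_row_0:
  assumes "j < q"
  shows "(companion q a ^\<^sub>m 0) $$ (0, j) = (if j = 0 then 1 else 0)"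
  using assms by (simp add: companion_def)

text \<open>Expanding \<open>d (T + h)\<close> backwards in time, the coefficients of the \<open>q\<close> most recent
  unexpanded lags form the first row of the powers of the companion matrix.\<close>

lemma autoregression_expansion:
  fixes d u :: "int \<Rightarrow> real"
  assumes q: "q \<ge> 1"
    and init: "\<And>t. t \<le> T \<Longrightarrow> d t = 0"
    and rec: "\<And>t. t > T \<Longrightarrow> d t = (\<Sum>l=1..q. a l * d (t - int l)) + u t"
  shows "d (T + int h) =
    (\<Sum>r<h. (companion q a ^\<^sub>m r) $$ (0, 0) * u (T + int h - int r))"
proof -
  let ?C = "companion q a"
  let ?b = "\<lambda>m j. (?C ^\<^sub>m m) $$ (0, j)"
  \<comment> \<open>After \<open>m\<close> substitutions the unexpanded lags sit at
    \<open>T + h - m - j\<close> with \<open>j < q\<close>. At \<open>m = h\<close> all of them are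
    at or before \<open>T\<close>, where \<open>init\<close> makes \<open>d\<close> vanish.\<close>
  have "d (T + int h) = (\<Sum>r<m. ?b r 0 * u (T + int h - int r))
      + (\<Sum>j<q. ?b m j * d (T + int h - int m - int j))" if "m \<le> h" for m
    using that
  proof (induction m)
    case 0
    have "(\<Sum>j<q. ?b 0 j * d (T + int h - int 0 - int j))
        = (\<Sum>j<q. if j = 0 then d (T + int h) else 0)"
      by (intro sum.cong) (auto simp: companion_pow_row_0 simp del: pow_mat.simps)
    then show ?case using q by simp
  next
    case (Suc m)
    let ?t = "T + int h - int m"
    \<comment> \<open>Only the most recent lag is substituted; the other \<open>q - 1\<close> move
      up one position, which is the shift term of \<open>companion_pow_row_Suc\<close>.\<close>
    have split: "{..<q} = insert 0 (Suc ` {..<q - 1})"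
      using q lessThan_Suc_eq_insert_0[of "q - 1"] by simp
    have "(\<Sum>j<q. ?b m j * d (?t - int j))
        = ?b m 0 * d ?t + (\<Sum>j<q-1. ?b m (Suc j) * d (?t - 1 - int j))"
      unfolding split by (simp add: sum.reindex algebra_simps)
    also have "d ?t = (\<Sum>j<q. a (Suc j) * d (?t - 1 - int j)) + u ?t"
    proof -
      have "(\<Sum>l=1..q. a l * d (?t - int l)) = (\<Sum>j<q. a (Suc j) * d (?t - 1 - int j))"
        by (rule sum.reindex_bij_witness[of _ Suc "\<lambda>l. l - 1"]) (auto simp: algebra_simps of_nat_diff)
      then show ?thesis using rec[of ?t] Suc.prems by simp
    qed
    also have "(\<Sum>j<q-1. ?b m (Suc j) * d (?t - 1 - int j))
        = (\<Sum>j<q. (if Suc j < q then ?b m (Suc j) else 0) * d (?t - 1 - int j))"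
      by (rule sum.mono_neutral_cong_left) auto
    also have "?b m 0 * ((\<Sum>j<q. a (Suc j) * d (?t - 1 - int j)) + u ?t) + \<dots>
        = ?b m 0 * u ?t + (\<Sum>j<q. ?b (Suc m) j * d (?t - 1 - int j))"
      by (simp add: companion_pow_row_Suc sum.distrib sum_distrib_left algebra_simps
          del: pow_mat.simps)
    finally show ?case using Suc by (simp add: algebra_simps del: pow_mat.simps)
  qed
  from this[of h] show ?thesis by (simp add: init)
qed

text \<open>Eigenvectors for distinct eigenvalues are orthogonal, so one eigenvector per eigenvalue
  gives an independent and therefore finite family. Finiteness is what gives \<open>Max\<close> in
  \<open>lambda_max\<close> its meaning.\<close>

lemma symmetric_eigenvalues_finite:
  fixes S :: "real ^ 'n::finite ^ 'n"
  assumes sym: "Finite_Cartesian_Product.transpose S = S"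
  shows "finite {c. \<exists>v. v \<noteq> 0 \<and> S *v v = c *\<^sub>R v}" (is "finite ?E")
proof -
  have S: "(S *v u) \<bullet> w = u \<bullet> (S *v w)" for u w
    using dot_lmul_matrix[of u S w] transpose_matrix_vector[of S u] by (simp add: sym)
  have "\<forall>c\<in>?E. \<exists>v. v \<noteq> 0 \<and> S *v v = c *\<^sub>R v" by simp
  from bchoice[OF this] obtain f where "\<forall>c\<in>?E. f c \<noteq> 0 \<and> S *v f c = c *\<^sub>R f c" ..
  then have f: "f c \<noteq> 0 \<and> S *v f c = c *\<^sub>R f c" if "c \<in> ?E" for c
    using that by (rule bspec)
  have orth: "f c \<bullet> f d = 0" if "c \<in> ?E" "d \<in> ?E" "c \<noteq> d" for c d
    using S[of "f c" "f d"] f[OF that(1)] f[OF that(2)] that(3) by simp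
  have inj: "inj_on f ?E"
  proof (rule inj_onI)
    fix c d assume *: "c \<in> ?E" "d \<in> ?E" "f c = f d"
    show "c = d"
    proof (rule ccontr)
      assume "c \<noteq> d"
      then have "f c \<bullet> f c = 0" using orth[OF *(1,2)] *(3) by simp
      then show False using f[OF *(1)] by simp
    qed
  qed
  have "pairwise orthogonal (f ` ?E)"
    unfolding pairwise_def orthogonal_def using orth by (metis (no_types, lifting) imageE)
  moreover have "0 \<notin> f ` ?E" using f by (metis (no_types, lifting) imageE)
  ultimately have "independent (f ` ?E)" by (rule pairwise_orthogonal_independent)
  then have "finite (f ` ?E)" by (rule independent_imp_finite)
  then show ?thesis using inj finite_imageD by blast
qed

text \<open>The quadratic form attains its maximum on the compact unit sphere. The first-order
  condition there makes the maximiser an eigenvector, and every other eigenvalue is a value of the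
  Rayleigh quotient, hence not larger.\<close>

lemma lambda_max_Rayleigh:
  fixes S :: "real ^ 'n::finite ^ 'n"
  assumes sym: "Finite_Cartesian_Product.transpose S = S"
  shows "v \<bullet> (S *v v) \<le> lambda_max S * (v \<bullet> v)"
    and "\<exists>v. v \<noteq> 0 \<and> v \<bullet> (S *v v) = lambda_max S * (v \<bullet> v)"
proof -
  let ?f = "\<lambda>v. v \<bullet> (S *v v)"
  have S: "(S *v u) \<bullet> w = u \<bullet> (S *v w)" for u w
    using dot_lmul_matrix[of u S w] transpose_matrix_vector[of S u] by (simp add: sym)
  have "continuous_on (sphere 0 1) ?f"
    by (intro continuous_intros matrix_vector_mult_linear_continuous_on)
  moreover have "sphere (0::real^'n) 1 \<noteq> {}" by simp
  ultimately obtain v0 where v0: "v0 \<in> sphere 0 1" and max: "\<And>v. v \<in> sphere 0 1 \<Longrightarrow> ?f v \<le> ?f v0"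
    using continuous_attains_sup[of "sphere (0::real^'n) 1" ?f] by auto
  define m where "m = ?f v0"
  have v01: "v0 \<bullet> v0 = 1" using v0 by (simp add: norm_eq_1)
  have R: "?f w \<le> m * (w \<bullet> w)" for w
  proof (cases "w = 0")
    case False
    define u where "u = w /\<^sub>R norm w"
    have w: "w = norm w *\<^sub>R u" using False by (simp add: u_def)
    have "?f u \<le> m" using max[of u] False by (simp add: u_def m_def)
    then have "(norm w)\<^sup>2 * ?f u \<le> (norm w)\<^sup>2 * m" by (intro mult_left_mono) auto
    also have "(norm w)\<^sup>2 * ?f u = ?f w"
      by (subst (2 3) w) (simp add: matrix_vector_mult_scaleR power2_eq_square)
    finally show ?thesis by (simp add: power2_norm_eq_inner mult.commute)
  qed simp
  \<comment> \<open>First-order condition: moving from \<open>v0\<close> along \<open>w\<close>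
    gives a quadratic in \<open>t\<close> without constant term that is never negative, so its
    linear coefficient is zero.\<close>
  have "w \<bullet> (m *\<^sub>R v0 - S *v v0) = 0" for w
  proof (rule ccontr)
    let ?b = "w \<bullet> (m *\<^sub>R v0 - S *v v0)" and ?c = "m * (w \<bullet> w) - ?f w"
    assume b: "?b \<noteq> 0"
    have c: "?c \<ge> 0" using R[of w] by simp
    have *: "0 \<le> 2 * t * ?b + t\<^sup>2 * ?c" for t
    proof -
      have "0 \<le> m * ((v0 + t *\<^sub>R w) \<bullet> (v0 + t *\<^sub>R w)) - ?f (v0 + t *\<^sub>R w)"
        using R[of "v0 + t *\<^sub>R w"] by simp
      also have "\<dots> = 2 * t * ?b + t\<^sup>2 * ?c"
        using S[of v0 w] v01
        by (simp add: matrix_vector_right_distrib matrix_vector_mult_scaleR inner_add_left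
            inner_add_right inner_diff_right m_def[symmetric] inner_commute[of w v0]
            inner_commute[of w "S *v v0"] power2_eq_square algebra_simps)
      finally show ?thesis .
    qed
    \<comment> \<open>The minimiser of \<open>2 * t * b + t\<^sup>2 * c\<close> is
      \<open>- b / c\<close>; the denominator \<open>1 + c\<close> also covers \<open>c = 0\<close>,
      and the value there is still negative.\<close>
    have neg: "2 * (- b / (1 + c)) * b + (- b / (1 + c))\<^sup>2 * c < 0"
      if "b \<noteq> 0" "c \<ge> 0" for b c :: real
    proof -
      define r where "r = b / (1 + c)"
      have b: "b = r * (1 + c)" and r: "r \<noteq> 0" using that by (auto simp: r_def)
      have "2 * (- r) * b + (- r)\<^sup>2 * c = - (r\<^sup>2 * (2 + c))"
        unfolding b by (simp add: algebra_simps power2_eq_square)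
      also have "\<dots> < 0" using r that(2) by simp
      finally show ?thesis by (simp add: r_def)
    qed
    show False using *[of "- ?b / (1 + ?c)"] neg[OF b c] by linarith
  qed
  from this[of "m *\<^sub>R v0 - S *v v0"] have eig: "S *v v0 = m *\<^sub>R v0" by simp
  have "lambda_max S = m"
    unfolding lambda_max_def
  proof (rule Max_eqI[OF symmetric_eigenvalues_finite[OF sym]])
    show "m \<in> {c. \<exists>v. v \<noteq> 0 \<and> S *v v = c *\<^sub>R v}"
    proof (intro CollectI exI conjI)
      show "v0 \<noteq> 0" using v01 by auto
      show "S *v v0 = m *\<^sub>R v0" by (rule eig)
    qed
    fix c assume "c \<in> {c. \<exists>v. v \<noteq> 0 \<and> S *v v = c *\<^sub>R v}"
    then obtain v where v: "v \<noteq> 0" "S *v v = c *\<^sub>R v" by auto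
    then show "c \<le> m" using R[of v] by simp
  qed
  then show "v \<bullet> (S *v v) \<le> lambda_max S * (v \<bullet> v)"
    and "\<exists>v. v \<noteq> 0 \<and> v \<bullet> (S *v v) = lambda_max S * (v \<bullet> v)"
    using R v01 m_def by (auto intro!: exI[of _ v0])
qed

section \<open>Averaged outer products and their largest eigenvalue\<close>

lemma mean_outer_symmetric:
  "Finite_Cartesian_Product.transpose (mean_outer q T v) = mean_outer q T v"
  by (simp add: mean_outer_def outer_def Finite_Cartesian_Product.transpose_def vec_eq_iff
      mult.commute)

lemma mean_outer_quadratic_form:
  "u \<bullet> (mean_outer q T v *v u) = (\<Sum>t\<in>{int q + 1..int T}. (u \<bullet> v t)\<^sup>2) / real T"
proof -
  have "u \<bullet> (outer (v t) *v u) = (u \<bullet> v t)\<^sup>2" for t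
    by (simp add: outer_def inner_vec_def matrix_vector_mult_def power2_eq_square sum_product
        sum_distrib_left algebra_simps)
  moreover have "(\<Sum>t\<in>F. outer (v t)) *v u = (\<Sum>t\<in>F. outer (v t) *v u)" for F :: "int set"
    by (induction F rule: infinite_finite_induct) (simp_all add: matrix_vector_mult_add_rdistrib)
  ultimately show ?thesis
    by (simp add: mean_outer_def scaleR_matrix_vector_assoc[symmetric] inner_sum_right)
qed

text \<open>The left side is the trace of \<open>mean_outer\<close>, and each diagonal entry is a
  Rayleigh quotient at a basis vector. The factor is the dimension, which stays fixed as
  \<open>T\<close> grows.\<close>

lemma mean_norm_sq_le_lambda_max:
  fixes v :: "int \<Rightarrow> real ^ 'n::finite"
  shows "(\<Sum>t\<in>{int q + 1..int T}. (norm (v t))\<^sup>2) / real T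
    \<le> real CARD('n) * lambda_max (mean_outer q T v)"
proof -
  let ?S = "mean_outer q T v"
  have "(norm (v t))\<^sup>2 = (\<Sum>i\<in>UNIV. (axis i 1 \<bullet> v t)\<^sup>2)" for t
    unfolding power2_norm_eq_inner inner_vec_def[of "v t"] by (simp add: inner_axis' power2_eq_square)
  then have "(\<Sum>t\<in>{int q + 1..int T}. (norm (v t))\<^sup>2) / real T
      = (\<Sum>i\<in>UNIV. axis i 1 \<bullet> (?S *v axis i 1))"
    unfolding mean_outer_quadratic_form sum_divide_distrib[symmetric]
    by (simp add: sum.swap[of _ UNIV])
  also have "\<dots> \<le> (\<Sum>i\<in>(UNIV::'n set). lambda_max ?S)"
    using lambda_max_Rayleigh(1)[OF mean_outer_symmetric, of "axis _ 1" q T v]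
    by (intro sum_mono) (simp add: inner_axis_axis)
  finally show ?thesis by simp
qed

text \<open>The \<open>o\<^sub>p\<close> hypotheses carry no information about an event outside the \<open>\<sigma>\<close>-algebra, whose measure
  is \<open>0\<close> by convention; hence the need for measurability of the largest eigenvalue.\<close>

lemma lambda_max_mean_outer_measurable:
  fixes v :: "int \<Rightarrow> 'w \<Rightarrow> real ^ 'n::finite"
  assumes [measurable]: "\<And>t. v t \<in> borel_measurable M"
  shows "(\<lambda>\<omega>. lambda_max (mean_outer q T (\<lambda>t. v t \<omega>))) \<in> borel_measurable M"
proof (rule borel_measurable_iff_greater[THEN iffD2], rule allI)
  fix c :: real
  let ?S = "\<lambda>\<omega>. mean_outer q T (\<lambda>t. v t \<omega>)"
  obtain Q :: "(real ^ 'n) set" where Q: "countable Q" "\<And>U. open U \<Longrightarrow> U \<noteq> {} \<Longrightarrow> \<exists>d\<in>Q. d \<in> U"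
    by (rule countable_dense_setE) blast
  \<comment> \<open>If the largest eigenvalue exceeds \<open>c\<close>, the vectors that witness it
    form a nonempty open set, so a countable dense set contains one. This reduces the event to a
    countable union.\<close>
  have "c < lambda_max (?S \<omega>) \<longleftrightarrow> (\<exists>u\<in>Q. c * (u \<bullet> u) < u \<bullet> (?S \<omega> *v u))" for \<omega>
  proof
    assume c: "c < lambda_max (?S \<omega>)"
    let ?U = "{u. c * (u \<bullet> u) < u \<bullet> (?S \<omega> *v u)}"
    obtain u where "u \<noteq> 0" "u \<bullet> (?S \<omega> *v u) = lambda_max (?S \<omega>) * (u \<bullet> u)"
      using lambda_max_Rayleigh(2)[OF mean_outer_symmetric] by blast
    then have "u \<in> ?U" using c by simp
    moreover have "open ?U"
      by (intro open_Collect_less continuous_intros matrix_vector_mult_linear_continuous_on)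
    ultimately show "\<exists>u\<in>Q. c * (u \<bullet> u) < u \<bullet> (?S \<omega> *v u)" using Q(2)[of ?U] by blast
  next
    assume "\<exists>u\<in>Q. c * (u \<bullet> u) < u \<bullet> (?S \<omega> *v u)"
    then obtain u where "c * (u \<bullet> u) < u \<bullet> (?S \<omega> *v u)" by blast
    also have "\<dots> \<le> lambda_max (?S \<omega>) * (u \<bullet> u)"
      by (rule lambda_max_Rayleigh(1)[OF mean_outer_symmetric])
    finally show "c < lambda_max (?S \<omega>)"
      by (metis inner_ge_zero mult_right_mono not_less)
  qed
  then have "{\<omega> \<in> space M. c < lambda_max (?S \<omega>)}
      = (\<Union>u\<in>Q. {\<omega> \<in> space M. c * (u \<bullet> u) < u \<bullet> (?S \<omega> *v u)})"
    by blast
  also have "\<dots> \<in> sets M"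
    unfolding mean_outer_quadratic_form using Q(1)
    by (intro sets.countable_UN'') measurable
  finally show "{\<omega> \<in> space M. c < lambda_max (?S \<omega>)} \<in> sets M" .
qed

text \<open>Since \<open>norm\<close> is the Frobenius norm, Cauchy--Schwarz in each row is
  enough.\<close>

lemma norm_matrix_vector_mult_le:
  fixes A :: "real ^ 'n::finite ^ 'm::finite"
  shows "norm (A *v x) \<le> norm A * norm x"
proof -
  have "norm (A *v x) = L2_set (\<lambda>i. norm ((A $ i) \<bullet> x)) UNIV"
    by (simp add: norm_vec_def[of "A *v x"] matrix_vector_mul_component)
  also have "\<dots> \<le> L2_set (\<lambda>i. norm (A $ i) * norm x) UNIV"
    by (intro L2_set_mono) (auto simp: Cauchy_Schwarz_ineq2)
  also have "\<dots> = norm A * norm x"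
    by (simp add: norm_vec_def[of A] L2_set_left_distrib)
  finally show ?thesis .
qed

section \<open>Convergence in probability\<close>

text \<open>Convergence in probability is convergence along a filter on pairs \<open>(T, \<omega>)\<close>, so that the
  library of limits along filters applies to it.\<close>

definition whp :: "'w measure \<Rightarrow> (nat \<times> 'w) filter" where
  "whp M = Abs_filter (\<lambda>P. \<forall>\<eta>>0. \<forall>\<^sub>F T in sequentially.
     \<exists>E\<in>sets M. measure M E \<ge> 1 - \<eta> \<and> (\<forall>\<omega>\<in>E. P (T, \<omega>)))"

text \<open>As in \<open>whp\<close>, the probability is that of a measurable event inside the set
  of interest, so the set itself may fail to be measurable. The bound may depend on \<eta>, whereas
  eventual boundedness along \<open>whp\<close> would ask for one bound for all \<eta>; hence a
  separate notion.\<close>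

definition bounded_in_prob :: "'w measure \<Rightarrow> (nat \<times> 'w \<Rightarrow> real) \<Rightarrow> bool" where
  "bounded_in_prob M X \<longleftrightarrow> (\<forall>\<eta>>0. \<exists>C. \<forall>\<^sub>F T in sequentially.
     \<exists>E\<in>sets M. measure M E \<ge> 1 - \<eta> \<and> (\<forall>\<omega>\<in>E. \<bar>X (T, \<omega>)\<bar> \<le> C))"

context prob_space
begin

lemma large_event_Int:
  assumes "E \<in> events" "F \<in> events" "prob E \<ge> 1 - \<eta>" "prob F \<ge> 1 - \<eta>'"
  shows "prob (E \<inter> F) \<ge> 1 - (\<eta> + \<eta>')"
proof -
  have "prob (E \<union> F) = prob E + prob F - prob (E \<inter> F)"
    using assms(1,2) measure_Un3[of E M F] by (simp add: fmeasurable_eq_sets)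
  moreover have "prob (E \<union> F) \<le> 1" by simp
  ultimately show ?thesis using assms(3,4) by simp
qed

text \<open>The filter property that takes work is closure under conjunction: each of the two events
  gets half of the allowance \<eta>, and the union bound adds the losses.\<close>

lemma eventually_whp:
  "eventually P (whp M) \<longleftrightarrow> (\<forall>\<eta>>0. \<forall>\<^sub>F T in sequentially.
     \<exists>E\<in>events. prob E \<ge> 1 - \<eta> \<and> (\<forall>\<omega>\<in>E. P (T, \<omega>)))"
  unfolding whp_def
proof (rule eventually_Abs_filter, rule is_filter.intro)
  show "\<forall>\<eta>>0. \<forall>\<^sub>F T in sequentially. \<exists>E\<in>events. 1 - \<eta> \<le> prob E \<and> (\<forall>\<omega>\<in>E. True)"
    by (auto intro!: always_eventually bexI[of _ "space M"] simp: prob_space)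
next
  fix P Q :: "nat \<times> 'a \<Rightarrow> bool"
  assume P: "\<forall>\<eta>>0. \<forall>\<^sub>F T in sequentially. \<exists>E\<in>events. 1 - \<eta> \<le> prob E \<and> (\<forall>\<omega>\<in>E. P (T, \<omega>))"
    and Q: "\<forall>\<eta>>0. \<forall>\<^sub>F T in sequentially. \<exists>E\<in>events. 1 - \<eta> \<le> prob E \<and> (\<forall>\<omega>\<in>E. Q (T, \<omega>))"
  show "\<forall>\<eta>>0. \<forall>\<^sub>F T in sequentially. \<exists>E\<in>events. 1 - \<eta> \<le> prob E
      \<and> (\<forall>\<omega>\<in>E. P (T, \<omega>) \<and> Q (T, \<omega>))"
  proof (intro allI impI)
    fix \<eta> :: real assume "\<eta> > 0"
    then have "\<eta> / 2 > 0" by simp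
    from P[rule_format, OF this] Q[rule_format, OF this]
    show "\<forall>\<^sub>F T in sequentially. \<exists>E\<in>events. 1 - \<eta> \<le> prob E
        \<and> (\<forall>\<omega>\<in>E. P (T, \<omega>) \<and> Q (T, \<omega>))"
    proof eventually_elim
      case (elim T)
      then obtain E F where "E \<in> events" "F \<in> events" "prob E \<ge> 1 - \<eta> / 2" "prob F \<ge> 1 - \<eta> / 2"
        "\<forall>\<omega>\<in>E. P (T, \<omega>)" "\<forall>\<omega>\<in>F. Q (T, \<omega>)" by blast
      then show ?case
        using large_event_Int[of E F "\<eta> / 2" "\<eta> / 2"] by (intro bexI[of _ "E \<inter> F"]) auto
    qed
  qed
next
  fix P Q :: "nat \<times> 'a \<Rightarrow> bool"
  assume "\<forall>x. P x \<longrightarrow> Q x"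
    and "\<forall>\<eta>>0. \<forall>\<^sub>F T in sequentially. \<exists>E\<in>events. 1 - \<eta> \<le> prob E \<and> (\<forall>\<omega>\<in>E. P (T, \<omega>))"
  then show "\<forall>\<eta>>0. \<forall>\<^sub>F T in sequentially. \<exists>E\<in>events. 1 - \<eta> \<le> prob E \<and> (\<forall>\<omega>\<in>E. Q (T, \<omega>))"
    by (auto elim!: eventually_mono intro!: rev_bexI)
qed

lemma eventually_whpI:
  assumes "\<forall>\<^sub>F T in sequentially. \<forall>\<omega>\<in>space M. P (T, \<omega>)"
  shows "eventually P (whp M)"
  unfolding eventually_whp using assms
  by (auto elim!: eventually_mono intro!: bexI[of _ "space M"] simp: prob_space)

lemma tendsto_whp_deterministic:
  assumes "f \<longlonglongrightarrow> c"
  shows "((\<lambda>p. f (fst p)) \<longlongrightarrow> c) (whp M)"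
proof (rule topological_tendstoI)
  fix S assume "open S" "c \<in> S"
  with assms have "eventually (\<lambda>T. f T \<in> S) sequentially" by (rule topological_tendstoD)
  then show "eventually (\<lambda>p. f (fst p) \<in> S) (whp M)"
    by (intro eventually_whpI) (auto elim: eventually_mono)
qed

lemma eventually_whpI_prob:
  assumes meas: "\<And>T. {\<omega> \<in> space M. \<not> P (T, \<omega>)} \<in> events"
    and lim: "(\<lambda>T. prob {\<omega> \<in> space M. \<not> P (T, \<omega>)}) \<longlonglongrightarrow> 0"
  shows "eventually P (whp M)"
  unfolding eventually_whp
proof (intro allI impI)
  fix \<eta> :: real assume "\<eta> > 0"
  with lim have "\<forall>\<^sub>F T in sequentially. prob {\<omega> \<in> space M. \<not> P (T, \<omega>)} < \<eta>"
    by (rule order_tendstoD)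
  then show "\<forall>\<^sub>F T in sequentially. \<exists>E\<in>events. 1 - \<eta> \<le> prob E \<and> (\<forall>\<omega>\<in>E. P (T, \<omega>))"
  proof eventually_elim
    case (elim T)
    then show ?case
      using meas[of T] prob_compl[OF meas[of T]]
      by (intro bexI[of _ "space M - {\<omega> \<in> space M. \<not> P (T, \<omega>)}"]) auto
  qed
qed

lemma whp_imp_prob_tendsto_0:
  assumes meas: "\<And>T. {\<omega> \<in> space M. \<not> P (T, \<omega>)} \<in> events"
    and ev: "eventually P (whp M)"
  shows "(\<lambda>T. prob {\<omega> \<in> space M. \<not> P (T, \<omega>)}) \<longlonglongrightarrow> 0"
proof (rule order_tendstoI)
  fix \<eta> :: real assume "\<eta> > 0"
  then have "\<eta> / 2 > 0" by simp
  with ev have "\<forall>\<^sub>F T in sequentially. \<exists>E\<in>events. 1 - \<eta> / 2 \<le> prob E \<and> (\<forall>\<omega>\<in>E. P (T, \<omega>))"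
    unfolding eventually_whp by blast
  then show "\<forall>\<^sub>F T in sequentially. prob {\<omega> \<in> space M. \<not> P (T, \<omega>)} < \<eta>"
  proof eventually_elim
    case (elim T)
    then obtain E where E: "E \<in> events" "1 - \<eta> / 2 \<le> prob E" "\<forall>\<omega>\<in>E. P (T, \<omega>)" by blast
    have "prob {\<omega> \<in> space M. \<not> P (T, \<omega>)} \<le> prob (space M - E)"
      using E by (intro finite_measure_mono) auto
    also have "\<dots> \<le> \<eta> / 2" using E prob_compl[of E] by simp
    finally show ?case using \<open>\<eta> > 0\<close> by simp
  qed
qed (auto intro!: always_eventually intro: less_le_trans)

lemma tendsto_in_probI:
  assumes [measurable]: "\<And>T. X T \<in> borel_measurable M"
    and "((\<lambda>p. X (fst p) (snd p)) \<longlongrightarrow> c) (whp M)"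
  shows "tendsto_in_prob M X c"
  unfolding tendsto_in_prob_def
proof (intro allI impI)
  fix e :: real assume e: "e > 0"
  let ?P = "\<lambda>p. \<not> \<bar>X (fst p) (snd p) - c\<bar> > e"
  have "eventually ?P (whp M)"
    using tendstoD[OF assms(2) e] by eventually_elim (simp add: dist_real_def)
  then have "(\<lambda>T. prob {\<omega> \<in> space M. \<not> ?P (T, \<omega>)}) \<longlonglongrightarrow> 0"
    by (intro whp_imp_prob_tendsto_0) (auto intro!: borel_measurable_less)
  then show "(\<lambda>T. prob {\<omega> \<in> space M. e < \<bar>X T \<omega> - c\<bar>}) \<longlonglongrightarrow> 0" by simp
qed

lemma smallo_probD:
  assumes [measurable]: "\<And>T. X T \<in> borel_measurable M"
    and X: "smallo_prob M X r" and r: "\<forall>\<^sub>F T in sequentially. r T > 0"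
  shows "((\<lambda>p. X (fst p) (snd p) / r (fst p)) \<longlongrightarrow> 0) (whp M)"
proof (rule tendstoI)
  fix e :: real assume e: "e > 0"
  \<comment> \<open>Half of \<open>e\<close>, because the complement of the exceptional event gives
    a weak inequality only, while the limit needs a strict one.\<close>
  let ?P = "\<lambda>p. \<not> \<bar>X (fst p) (snd p)\<bar> > (e / 2) * \<bar>r (fst p)\<bar>"
  have "eventually ?P (whp M)"
  proof (rule eventually_whpI_prob)
    show "(\<lambda>T. prob {\<omega> \<in> space M. \<not> ?P (T, \<omega>)}) \<longlonglongrightarrow> 0"
      using X[unfolded smallo_prob_def, rule_format, OF half_gt_zero[OF e]]
      by (simp only: not_not fst_conv snd_conv)
  qed simp
  moreover have "eventually (\<lambda>p. r (fst p) > 0) (whp M)"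
    using r by (intro eventually_whpI) (auto elim: eventually_mono)
  ultimately show "eventually (\<lambda>p. dist (X (fst p) (snd p) / r (fst p)) 0 < e) (whp M)"
  proof eventually_elim
    case (elim p)
    have "\<bar>X (fst p) (snd p)\<bar> \<le> e / 2 * r (fst p)" using elim by simp
    also have "\<dots> < e * r (fst p)" using elim e by simp
    finally show ?case using elim by (simp add: dist_real_def abs_divide divide_less_eq)
  qed
qed

lemma bigO_probD:
  assumes [measurable]: "\<And>T. X T \<in> borel_measurable M"
    and X: "bigO_prob M X (\<lambda>T. inverse (r T))" and r: "\<forall>\<^sub>F T in sequentially. r T > 0"
  shows "bounded_in_prob M (\<lambda>p. r (fst p) * X (fst p) (snd p))"
  unfolding bounded_in_prob_def
proof (intro allI impI)
  fix \<eta> :: real assume "\<eta> > 0"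
  with X obtain C where "\<forall>\<^sub>F T in sequentially.
      prob {\<omega> \<in> space M. \<bar>X T \<omega>\<bar> > C * \<bar>inverse (r T)\<bar>} \<le> \<eta>"
    unfolding bigO_prob_def by blast
  with r have "\<forall>\<^sub>F T in sequentially. \<exists>E\<in>events. 1 - \<eta> \<le> prob E \<and> (\<forall>\<omega>\<in>E. \<bar>r T * X T \<omega>\<bar> \<le> C)"
  proof eventually_elim
    case (elim T)
    let ?B = "{\<omega> \<in> space M. \<bar>X T \<omega>\<bar> > C * \<bar>inverse (r T)\<bar>}"
    have "?B \<in> events" by measurable
    moreover have "\<bar>r T * X T \<omega>\<bar> \<le> C" if "\<omega> \<in> space M - ?B" for \<omega>
      using that elim(1) by (simp add: abs_mult not_less field_simps)
    ultimately show ?case using elim(2) prob_compl[of ?B] by (intro bexI[of _ "space M - ?B"]) auto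
  qed
  then show "\<exists>C. \<forall>\<^sub>F T in sequentially.
      \<exists>E\<in>events. 1 - \<eta> \<le> prob E \<and> (\<forall>\<omega>\<in>E. \<bar>r (fst (T, \<omega>)) * X (fst (T, \<omega>)) (snd (T, \<omega>))\<bar> \<le> C)"
    by auto
qed

lemma bounded_in_prob_mult_tendsto_0:
  assumes X: "bounded_in_prob M X" and Y: "(Y \<longlongrightarrow> 0) (whp M)"
  shows "((\<lambda>p. X p * Y p) \<longlongrightarrow> 0) (whp M)"
proof (rule tendstoI)
  fix e :: real assume e: "e > 0"
  show "eventually (\<lambda>p. dist (X p * Y p) 0 < e) (whp M)"
    unfolding eventually_whp
  proof (intro allI impI)
    fix \<eta> :: real assume "\<eta> > 0"
    then have \<eta>: "\<eta> / 2 > 0" by simp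
    obtain C where C: "\<forall>\<^sub>F T in sequentially.
        \<exists>E\<in>events. prob E \<ge> 1 - \<eta> / 2 \<and> (\<forall>\<omega>\<in>E. \<bar>X (T, \<omega>)\<bar> \<le> C)"
      using X \<eta> unfolding bounded_in_prob_def by blast
    have "e / (1 + \<bar>C\<bar>) > 0" using e by simp
    from tendstoD[OF Y this] \<eta> have "\<forall>\<^sub>F T in sequentially.
        \<exists>E\<in>events. prob E \<ge> 1 - \<eta> / 2 \<and> (\<forall>\<omega>\<in>E. dist (Y (T, \<omega>)) 0 < e / (1 + \<bar>C\<bar>))"
      unfolding eventually_whp by blast
    with C show "\<forall>\<^sub>F T in sequentially.
        \<exists>E\<in>events. prob E \<ge> 1 - \<eta> \<and> (\<forall>\<omega>\<in>E. dist (X (T, \<omega>) * Y (T, \<omega>)) 0 < e)"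
    proof eventually_elim
      case (elim T)
      then obtain E F where EF: "E \<in> events" "F \<in> events" "prob E \<ge> 1 - \<eta> / 2" "prob F \<ge> 1 - \<eta> / 2"
        "\<forall>\<omega>\<in>E. \<bar>X (T, \<omega>)\<bar> \<le> C" "\<forall>\<omega>\<in>F. dist (Y (T, \<omega>)) 0 < e / (1 + \<bar>C\<bar>)"
        by blast
      have "dist (X (T, \<omega>) * Y (T, \<omega>)) 0 < e" if "\<omega> \<in> E \<inter> F" for \<omega>
      proof -
        have "\<bar>X (T, \<omega>)\<bar> * \<bar>Y (T, \<omega>)\<bar> \<le> (1 + \<bar>C\<bar>) * \<bar>Y (T, \<omega>)\<bar>"
          using EF(5) that by (intro mult_right_mono) force+
        also have "\<dots> < (1 + \<bar>C\<bar>) * (e / (1 + \<bar>C\<bar>))"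
          using EF(6) that by (intro mult_strict_left_mono) (auto simp: dist_real_def)
        finally show ?thesis by (simp add: dist_real_def abs_mult)
      qed
      then show ?case
        using EF(1-4) large_event_Int[of E F "\<eta> / 2" "\<eta> / 2"] by (intro bexI[of _ "E \<inter> F"]) auto
    qed
  qed
qed

lemma bounded_in_prob_mono:
  assumes X: "bounded_in_prob M X"
    and le: "\<forall>\<^sub>F T in sequentially. \<forall>\<omega>\<in>space M. \<bar>Y (T, \<omega>)\<bar> \<le> \<bar>X (T, \<omega>)\<bar>"
  shows "bounded_in_prob M Y"
  unfolding bounded_in_prob_def
proof (intro allI impI)
  fix \<eta> :: real assume "\<eta> > 0"
  with X obtain C where "\<forall>\<^sub>F T in sequentially.
      \<exists>E\<in>events. prob E \<ge> 1 - \<eta> \<and> (\<forall>\<omega>\<in>E. \<bar>X (T, \<omega>)\<bar> \<le> C)"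
    unfolding bounded_in_prob_def by blast
  with le have "\<forall>\<^sub>F T in sequentially. \<exists>E\<in>events. prob E \<ge> 1 - \<eta> \<and> (\<forall>\<omega>\<in>E. \<bar>Y (T, \<omega>)\<bar> \<le> C)"
  proof eventually_elim
    case (elim T)
    then obtain E where E: "E \<in> events" "prob E \<ge> 1 - \<eta>" "\<forall>\<omega>\<in>E. \<bar>X (T, \<omega>)\<bar> \<le> C" by blast
    have "\<bar>Y (T, \<omega>)\<bar> \<le> C" if "\<omega> \<in> E" for \<omega>
      using elim(1) E(3) that sets.sets_into_space[OF E(1)] by force
    with E show ?case by blast
  qed
  then show "\<exists>C. \<forall>\<^sub>F T in sequentially.
      \<exists>E\<in>events. prob E \<ge> 1 - \<eta> \<and> (\<forall>\<omega>\<in>E. \<bar>Y (T, \<omega>)\<bar> \<le> C)" ..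
qed

lemma bounded_in_prob_const: "bounded_in_prob M (\<lambda>_. c)"
  unfolding bounded_in_prob_def
  by (auto intro!: exI[of _ "\<bar>c\<bar>"] always_eventually bexI[of _ "space M"] simp: prob_space)

lemma bounded_in_prob_add:
  assumes "bounded_in_prob M X" "bounded_in_prob M Y"
  shows "bounded_in_prob M (\<lambda>p. X p + Y p)"
  unfolding bounded_in_prob_def
proof (intro allI impI)
  fix \<eta> :: real assume "\<eta> > 0"
  then have \<eta>: "\<eta> / 2 > 0" by simp
  obtain C where C: "\<forall>\<^sub>F T in sequentially.
      \<exists>E\<in>events. prob E \<ge> 1 - \<eta> / 2 \<and> (\<forall>\<omega>\<in>E. \<bar>X (T, \<omega>)\<bar> \<le> C)"
    using assms(1) \<eta> unfolding bounded_in_prob_def by blast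
  obtain C' where "\<forall>\<^sub>F T in sequentially.
      \<exists>E\<in>events. prob E \<ge> 1 - \<eta> / 2 \<and> (\<forall>\<omega>\<in>E. \<bar>Y (T, \<omega>)\<bar> \<le> C')"
    using assms(2) \<eta> unfolding bounded_in_prob_def by blast
  with C have "\<forall>\<^sub>F T in sequentially.
      \<exists>E\<in>events. prob E \<ge> 1 - \<eta> \<and> (\<forall>\<omega>\<in>E. \<bar>X (T, \<omega>) + Y (T, \<omega>)\<bar> \<le> C + C')"
  proof eventually_elim
    case (elim T)
    then obtain E F where EF: "E \<in> events" "F \<in> events" "prob E \<ge> 1 - \<eta> / 2" "prob F \<ge> 1 - \<eta> / 2"
      "\<forall>\<omega>\<in>E. \<bar>X (T, \<omega>)\<bar> \<le> C" "\<forall>\<omega>\<in>F. \<bar>Y (T, \<omega>)\<bar> \<le> C'"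
      by blast
    then have "\<bar>X (T, \<omega>) + Y (T, \<omega>)\<bar> \<le> C + C'" if "\<omega> \<in> E \<inter> F" for \<omega>
      using that by (intro abs_triangle_ineq[THEN order_trans] add_mono) auto
    then show ?case
      using EF(1-4) large_event_Int[of E F "\<eta> / 2" "\<eta> / 2"] by (intro bexI[of _ "E \<inter> F"]) auto
  qed
  then show "\<exists>C. \<forall>\<^sub>F T in sequentially.
      \<exists>E\<in>events. prob E \<ge> 1 - \<eta> \<and> (\<forall>\<omega>\<in>E. \<bar>X (T, \<omega>) + Y (T, \<omega>)\<bar> \<le> C)" ..
qed

lemma bounded_in_prob_cmult:
  assumes X: "bounded_in_prob M X"
  shows "bounded_in_prob M (\<lambda>p. c * X p)"
  unfolding bounded_in_prob_def
proof (intro allI impI)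
  fix \<eta> :: real assume "\<eta> > 0"
  with X obtain C where "\<forall>\<^sub>F T in sequentially.
      \<exists>E\<in>events. prob E \<ge> 1 - \<eta> \<and> (\<forall>\<omega>\<in>E. \<bar>X (T, \<omega>)\<bar> \<le> C)"
    unfolding bounded_in_prob_def by blast
  then have "\<forall>\<^sub>F T in sequentially.
      \<exists>E\<in>events. prob E \<ge> 1 - \<eta> \<and> (\<forall>\<omega>\<in>E. \<bar>c * X (T, \<omega>)\<bar> \<le> \<bar>c\<bar> * C)"
    by (rule eventually_mono) (auto simp: abs_mult intro!: mult_left_mono intro: rev_bexI)
  then show "\<exists>C. \<forall>\<^sub>F T in sequentially.
      \<exists>E\<in>events. prob E \<ge> 1 - \<eta> \<and> (\<forall>\<omega>\<in>E. \<bar>c * X (T, \<omega>)\<bar> \<le> C)" ..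
qed

lemma bounded_in_prob_sum:
  assumes "\<And>i. i \<in> I \<Longrightarrow> bounded_in_prob M (X i)"
  shows "bounded_in_prob M (\<lambda>p. \<Sum>i\<in>I. X i p)"
  using assms
  by (induction I rule: infinite_finite_induct) (auto intro: bounded_in_prob_add bounded_in_prob_const)

lemma bounded_in_prob_expectation:
  assumes int: "\<forall>\<^sub>F T in sequentially. integrable M (X T) \<and> expectation (X T) \<le> C"
    and nonneg: "\<And>T \<omega>. X T \<omega> \<ge> 0"
  shows "bounded_in_prob M (\<lambda>p. X (fst p) (snd p))"
  unfolding bounded_in_prob_def
proof (intro allI impI)
  fix \<eta> :: real assume \<eta>: "\<eta> > 0"
  \<comment> \<open>Markov's inequality gives \<open>\<bar>C\<bar> / K\<close>, which is at most
    \<eta> for this \<open>K\<close>; the added 1 keeps \<open>K\<close> positive when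
    \<open>C = 0\<close>.\<close>
  define K where "K = (\<bar>C\<bar> + 1) / \<eta>"
  have K: "K > 0" using \<eta> by (simp add: K_def)
  from int have "\<forall>\<^sub>F T in sequentially. \<exists>E\<in>events. prob E \<ge> 1 - \<eta> \<and> (\<forall>\<omega>\<in>E. \<bar>X T \<omega>\<bar> \<le> K)"
  proof eventually_elim
    case (elim T)
    have [measurable]: "X T \<in> borel_measurable M" using elim by auto
    let ?B = "{\<omega> \<in> space M. X T \<omega> \<ge> K}"
    have B: "?B \<in> events" by measurable
    have "prob ?B \<le> expectation (X T) / K"
      using elim nonneg K by (intro integral_Markov_inequality_measure[where A = "{}"]) auto
    also have "\<dots> \<le> \<bar>C\<bar> / K" using elim K by (intro divide_right_mono) auto
    also have "\<dots> \<le> \<eta>" using \<eta> by (simp add: K_def field_simps)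
    finally have "prob (space M - ?B) \<ge> 1 - \<eta>" using prob_compl[OF B] by simp
    moreover have "\<forall>\<omega>\<in>space M - ?B. \<bar>X T \<omega>\<bar> \<le> K" using nonneg[of T] by (auto simp: not_le)
    ultimately show ?case using B by (intro bexI[of _ "space M - ?B"]) auto
  qed
  then show "\<exists>C. \<forall>\<^sub>F T in sequentially.
      \<exists>E\<in>events. prob E \<ge> 1 - \<eta> \<and> (\<forall>\<omega>\<in>E. \<bar>X (fst (T, \<omega>)) (snd (T, \<omega>))\<bar> \<le> C)"
    by auto
qed

lemma mean_square_tendsto_whp:
  fixes X :: "nat \<Rightarrow> 'a \<Rightarrow> real"
  assumes int: "\<And>T. integrable M (\<lambda>\<omega>. (X T \<omega>)\<^sup>2)" and [measurable]: "\<And>T. X T \<in> borel_measurable M"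
    and lim: "(\<lambda>T. expectation (\<lambda>\<omega>. (X T \<omega>)\<^sup>2)) \<longlonglongrightarrow> 0"
  shows "((\<lambda>p. X (fst p) (snd p)) \<longlongrightarrow> 0) (whp M)"
proof (rule tendstoI)
  fix e :: real assume e: "e > 0"
  show "eventually (\<lambda>p. dist (X (fst p) (snd p)) 0 < e) (whp M)"
  proof (rule eventually_whpI_prob)
    have le: "prob {\<omega> \<in> space M. \<not> \<bar>X T \<omega>\<bar> < e} \<le> expectation (\<lambda>\<omega>. (X T \<omega>)\<^sup>2) / e\<^sup>2" for T
    proof -
      have "prob {\<omega> \<in> space M. (X T \<omega>)\<^sup>2 \<ge> e\<^sup>2} \<le> expectation (\<lambda>\<omega>. (X T \<omega>)\<^sup>2) / e\<^sup>2"
        using e int by (intro integral_Markov_inequality_measure[where A = "{}"]) auto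
      also have "{\<omega> \<in> space M. (X T \<omega>)\<^sup>2 \<ge> e\<^sup>2} = {\<omega> \<in> space M. \<not> \<bar>X T \<omega>\<bar> < e}"
        using e by (auto simp: abs_le_square_iff[symmetric] not_less)
      finally show ?thesis .
    qed
    have "(\<lambda>T. expectation (\<lambda>\<omega>. (X T \<omega>)\<^sup>2) / e\<^sup>2) \<longlonglongrightarrow> 0"
      using tendsto_divide[OF lim tendsto_const, of "e\<^sup>2"] e by simp
    then have "(\<lambda>T. prob {\<omega> \<in> space M. \<not> \<bar>X T \<omega>\<bar> < e}) \<longlonglongrightarrow> 0"
      by (rule Lim_null_comparison[OF always_eventually, rotated]) (use le in simp)
    then show "(\<lambda>T. prob {\<omega> \<in> space M. \<not> dist (X (fst (T, \<omega>)) (snd (T, \<omega>))) 0 < e}) \<longlonglongrightarrow> 0"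
      by (simp add: dist_real_def)
  qed simp
qed

end

section \<open>Normal laws\<close>

context prob_space
begin

text \<open>The second moment identifies the limit of the averaged squares, and the fourth gives
  these squares the variance needed for Chebyshev's inequality. The point mass at
  \<open>v = 0\<close> has no density and is treated separately.\<close>

lemma normal_law_moments:
  assumes [measurable]: "X \<in> borel_measurable M"
    and law: "distr M borel X = normal_law 0 v" and v: "v \<ge> 0"
  shows "integrable M (\<lambda>\<omega>. X \<omega> ^ 2)" "integrable M (\<lambda>\<omega>. X \<omega> ^ 4)"
    "expectation (\<lambda>\<omega>. X \<omega> ^ 2) = v" "expectation (\<lambda>\<omega>. X \<omega> ^ 4) = 3 * v\<^sup>2"
proof -
  have even: "integrable (normal_law 0 v) (\<lambda>x. x ^ (2 * k)) \<and> (k \<ge> 1 \<longrightarrow>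
      integral\<^sup>L (normal_law 0 v) (\<lambda>x. x ^ (2 * k)) = fact (2 * k) * v ^ k / (2 ^ k * fact k))" for k
  proof (cases "v = 0")
    case True
    then show ?thesis
      by (auto simp: normal_law_def integral_return integrable_iff_bounded nn_integral_return
          zero_power)
  next
    case False
    have "fact (2 * k) / ((2 / v) ^ k * fact k) = fact (2 * k) * v ^ k / (2 ^ k * fact k)"
      using False by (simp add: power_divide field_simps)
    then have "has_bochner_integral lborel (\<lambda>x. normal_density 0 (sqrt v) x * x ^ (2 * k))
        (fact (2 * k) * v ^ k / (2 ^ k * fact k))"
      using normal_moment_even[of "sqrt v" 0 k] v False by (simp only: diff_zero real_sqrt_pow2) simp
    with False show ?thesis
      by (simp add: normal_law_def integrable_density integral_density has_bochner_integral_iff)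
  qed
  have int: "integrable M (\<lambda>\<omega>. X \<omega> ^ (2 * k))"
    and exp: "k \<ge> 1 \<Longrightarrow> expectation (\<lambda>\<omega>. X \<omega> ^ (2 * k)) = fact (2 * k) * v ^ k / (2 ^ k * fact k)" for k
    using even[of k] law integrable_distr_eq[of X M borel "\<lambda>x. x ^ (2 * k)"]
      integral_distr[of X M borel "\<lambda>x. x ^ (2 * k)"]
    by auto
  show "integrable M (\<lambda>\<omega>. X \<omega> ^ 2)" "integrable M (\<lambda>\<omega>. X \<omega> ^ 4)"
    using int[of 1] int[of 2] by simp_all
  show "expectation (\<lambda>\<omega>. X \<omega> ^ 2) = v" "expectation (\<lambda>\<omega>. X \<omega> ^ 4) = 3 * v\<^sup>2"
    using exp[of 1] exp[of 2] by (simp_all add: fact_numeral)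
qed

lemma normal_law_distributed:
  assumes [measurable]: "X \<in> borel_measurable M"
    and law: "distr M borel X = normal_law 0 v" and v: "v > 0"
  shows "distributed M lborel X (normal_density 0 (sqrt v))"
proof -
  have "distr M lborel X = distr M borel X" by (rule distr_cong) auto
  then show ?thesis using law v by (auto simp: distributed_def normal_law_def)
qed

text \<open>Chebyshev's inequality suffices: the centred squares are orthogonal by independence,
  each with variance \<open>3 * v\<^sup>2 - v\<^sup>2\<close>, so their average has mean square
  \<open>2 * v\<^sup>2 / (T - q)\<close> once \<open>T > q\<close>.\<close>

lemma weak_law_normal_squares:
  fixes e :: "int \<Rightarrow> 'a \<Rightarrow> real"
  assumes indep: "indep_vars (\<lambda>_. borel) e UNIV"
    and law: "\<And>t. distr M borel (e t) = normal_law 0 v" and v: "v \<ge> 0"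
  shows "((\<lambda>p. (\<Sum>t\<in>{int q + 1..int (fst p)}. (e t (snd p))\<^sup>2) / (real (fst p) - real q)) \<longlongrightarrow> v) (whp M)"
proof -
  have [measurable]: "e t \<in> borel_measurable M" for t
    using indep by (auto simp: indep_vars_def)
  note mom = normal_law_moments[OF _ law v]
  define W where "W t \<omega> = (e t \<omega>)\<^sup>2 - v" for t \<omega>
  have [measurable]: "W t \<in> borel_measurable M" for t
    unfolding W_def[abs_def] by measurable
  have W0: "expectation (W t) = 0" "integrable M (W t)" for t
    using mom(1,3)[of t] unfolding W_def by (simp_all add: prob_space)
  have WW: "integrable M (\<lambda>\<omega>. W s \<omega> * W t \<omega>) \<and>
      expectation (\<lambda>\<omega>. W s \<omega> * W t \<omega>) = (if s = t then 2 * v\<^sup>2 else 0)" for s t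
  proof (cases "s = t")
    case True
    have "W s \<omega> * W t \<omega> = e t \<omega> ^ 4 - 2 * v * (e t \<omega>)\<^sup>2 + v\<^sup>2" for \<omega>
      using True by (simp add: W_def power2_eq_square power4_eq_xxxx algebra_simps)
    then show ?thesis
      using mom[of t] True by (simp add: prob_space power2_eq_square)
  next
    case False
    have ind: "indep_vars (\<lambda>_. borel) W {s, t}"
      using indep_vars_compose2[OF indep_vars_subset[OF indep], of "{s, t}" "\<lambda>_ x. x\<^sup>2 - v"]
      unfolding W_def by simp
    show ?thesis
      using indep_vars_lebesgue_integral[OF _ ind] indep_vars_integrable[OF _ ind] W0 False by simp
  qed
  define S where "S T \<omega> = (\<Sum>t\<in>{int q + 1..int T}. W t \<omega>) / (real T - real q)" for T \<omega>
  have sq: "(S T \<omega>)\<^sup>2 = (\<Sum>s\<in>{int q + 1..int T}. \<Sum>t\<in>{int q + 1..int T}. W s \<omega> * W t \<omega>)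
      / (real T - real q)\<^sup>2" for T \<omega>
    by (simp add: S_def power_divide power2_eq_square sum_product)
  have ES: "expectation (\<lambda>\<omega>. (S T \<omega>)\<^sup>2) = 2 * v\<^sup>2 * real (T - q) / (real T - real q)\<^sup>2" for T
  proof -
    have "expectation (\<lambda>\<omega>. (S T \<omega>)\<^sup>2) = (\<Sum>s\<in>{int q + 1..int T}. \<Sum>t\<in>{int q + 1..int T}.
        expectation (\<lambda>\<omega>. W s \<omega> * W t \<omega>)) / (real T - real q)\<^sup>2"
      unfolding sq using WW by (simp add: integral_sum)
    also have "\<dots> = (\<Sum>s\<in>{int q + 1..int T}. \<Sum>t\<in>{int q + 1..int T}. if s = t then 2 * v\<^sup>2 else 0)
        / (real T - real q)\<^sup>2"
      using WW by (simp only:)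
    also have "\<dots> = 2 * v\<^sup>2 * real (nat (int T - int q)) / (real T - real q)\<^sup>2" by simp
    also have "nat (int T - int q) = T - q" by linarith
    finally show ?thesis .
  qed
  have intS: "integrable M (\<lambda>\<omega>. (S T \<omega>)\<^sup>2)" for T
    unfolding sq using WW by auto
  have "(\<lambda>T. 2 * v\<^sup>2 / (real T - real q)) \<longlonglongrightarrow> 0"
    by real_asymp
  moreover have "\<forall>\<^sub>F T in sequentially. 2 * v\<^sup>2 / (real T - real q) = expectation (\<lambda>\<omega>. (S T \<omega>)\<^sup>2)"
    using eventually_gt_at_top[of q]
    by eventually_elim (subst ES, simp add: of_nat_diff power2_eq_square)
  ultimately have "(\<lambda>T. expectation (\<lambda>\<omega>. (S T \<omega>)\<^sup>2)) \<longlonglongrightarrow> 0"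
    by (rule Lim_transform_eventually)
  then have "((\<lambda>p. S (fst p) (snd p)) \<longlongrightarrow> 0) (whp M)"
    using intS by (intro mean_square_tendsto_whp) (auto simp: S_def)
  then have "((\<lambda>p. v + S (fst p) (snd p)) \<longlongrightarrow> v + 0) (whp M)"
    by (intro tendsto_intros)
  moreover have "eventually (\<lambda>p. v + S (fst p) (snd p) =
      (\<Sum>t\<in>{int q + 1..int (fst p)}. (e t (snd p))\<^sup>2) / (real (fst p) - real q)) (whp M)"
  proof (rule eventually_whpI)
    show "\<forall>\<^sub>F T in sequentially. \<forall>\<omega>\<in>space M. v + S (fst (T, \<omega>)) (snd (T, \<omega>)) =
      (\<Sum>t\<in>{int q + 1..int (fst (T, \<omega>))}. (e t (snd (T, \<omega>)))\<^sup>2) / (real (fst (T, \<omega>)) - real q)"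
      using eventually_gt_at_top[of q]
      by eventually_elim (auto simp: S_def W_def sum_subtractf field_simps nat_diff_distrib' of_nat_diff)
  qed
  ultimately show ?thesis
    by (auto intro: Lim_transform_eventually)
qed

end

text \<open>With \<open>w\<close> the absolute value of the quantile, \<open>- w\<close> does not
  exceed the quantile, so the distribution function is at most \<open>p\<close> to the left of
  \<open>- w\<close>. Absence of atoms extends this to \<open>- w\<close> itself, and reflection
  treats the other tail. Working with inequalities avoids inverting the distribution function. The
  interval is open because it will be exhausted from inside.\<close>

lemma std_normal_symmetric_interval:
  assumes "p > 0"
  shows "measure std_normal_distribution {x. \<bar>x\<bar> < \<bar>normal_quantile p\<bar>} \<ge> 1 - 2 * p"
proof -
  let ?N = std_normal_distribution and ?w = "\<bar>normal_quantile p\<bar>"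
  interpret N: real_distribution ?N by (rule real_dist_normal_dist)
  have atom: "measure ?N {x} = 0" for x
  proof -
    have "AE y in lborel. y \<in> {x} \<longrightarrow> ennreal (std_normal_density y) = 0"
      using AE_lborel_singleton[of x] by eventually_elim simp
    then have "{x} \<in> null_sets ?N"
      by (subst null_sets_density_iff) simp_all
    then show ?thesis by (simp add: measure_eq_0_null_sets)
  qed
  \<comment> \<open>Here \<open>p > 0\<close> matters: it makes the set in
    \<open>normal_quantile\<close> bounded below, without which its \<open>Inf\<close> would tell
    nothing.\<close>
  have "\<forall>\<^sub>F c in at_bot. cdf ?N c < p"
    using N.cdf_lim_at_bot assms by (rule order_tendstoD)
  then obtain c0 where c0: "\<And>c. c \<le> c0 \<Longrightarrow> cdf ?N c < p"
    by (auto simp: eventually_at_bot_linorder)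
  have bdd: "bdd_below {c. p \<le> cdf ?N c}"
  proof (rule bdd_belowI[of _ c0])
    fix c assume "c \<in> {c. p \<le> cdf ?N c}"
    then show "c0 \<le> c" using c0[of c] by (cases "c \<le> c0") auto
  qed
  have below: "cdf ?N c \<le> p" if "c < - ?w" for c
  proof (rule ccontr)
    assume "\<not> cdf ?N c \<le> p"
    then have "normal_quantile p \<le> c"
      unfolding normal_quantile_def using bdd by (intro cInf_lower) auto
    then show False using that by linarith
  qed
  have lower: "measure ?N {.. - ?w} \<le> p"
  proof -
    have "(cdf ?N \<longlongrightarrow> cdf ?N (- ?w)) (at_left (- ?w))"
      using N.isCont_cdf[of "- ?w"] atom by (simp add: isCont_def filterlim_at_split)
    moreover have "eventually (\<lambda>c. cdf ?N c \<le> p) (at_left (- ?w))"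
      using eventually_at_left_real[of "- ?w - 1" "- ?w"] below by (auto elim: eventually_mono)
    ultimately have "cdf ?N (- ?w) \<le> p" by (intro tendsto_upperbound) auto
    then show ?thesis by (simp add: cdf_def)
  qed
  have upper: "measure ?N {?w ..} \<le> p"
  proof -
    have "distributed ?N lborel (\<lambda>x. x) (normal_density 0 1)"
      unfolding distributed_def
      by (auto simp: distr_id2 intro!: measure_eqI)
    then have "distributed ?N lborel (\<lambda>x. 0 + (- 1) * x) (normal_density (0 + (- 1) * 0) (\<bar>- 1\<bar> * 1))"
      by (rule N.normal_density_affine) auto
    then have d: "distr ?N lborel (\<lambda>x. - x) = ?N" by (simp add: distributed_def)
    have "measure ?N {.. - ?w} = measure (distr ?N lborel (\<lambda>x. - x)) {.. - ?w}" by (simp add: d)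
    also have "\<dots> = measure ?N ((\<lambda>x. - x) -` {.. - ?w} \<inter> space ?N)"
      by (intro measure_distr) auto
    also have "(\<lambda>x. - x) -` {.. - ?w} \<inter> space ?N = {?w ..}" by auto
    finally show ?thesis using lower by simp
  qed
  have "1 = measure ?N ({x. \<bar>x\<bar> < ?w} \<union> ({.. - ?w} \<union> {?w ..}))"
  proof -
    have "{x. \<bar>x\<bar> < ?w} \<union> ({.. - ?w} \<union> {?w ..}) = space ?N" by auto
    then show ?thesis using N.prob_space by simp
  qed
  also have "\<dots> \<le> measure ?N {x. \<bar>x\<bar> < ?w} + measure ?N ({.. - ?w} \<union> {?w ..})"
    by (intro measure_Un_le) auto
  also have "measure ?N ({.. - ?w} \<union> {?w ..}) \<le> measure ?N {.. - ?w} + measure ?N {?w ..}"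
    by (intro measure_Un_le) auto
  finally show ?thesis using lower upper by simp
qed

context prob_space
begin

text \<open>A Slutsky argument; since the law of \<open>U T\<close> does not depend on \<open>T\<close>, only the continuity from
  below of the normal law is needed.\<close>

lemma normal_interval_coverage:
  assumes normal: "\<And>T. distributed M lborel (U T) (normal_density 0 s)" and s: "s > 0"
    and V: "((\<lambda>p. V (fst p) (snd p)) \<longlongrightarrow> 0) (whp M)"
    and W: "((\<lambda>p. W (fst p) (snd p)) \<longlongrightarrow> \<bar>normal_quantile (\<alpha> / 2)\<bar> * s) (whp M)"
    and \<alpha>: "\<alpha> > 0"
    and meas: "\<And>T. {\<omega> \<in> space M. \<bar>U T \<omega> + V T \<omega>\<bar> \<le> W T \<omega>} \<in> events"
  shows "liminf (\<lambda>T. ereal (prob {\<omega> \<in> space M. \<bar>U T \<omega> + V T \<omega>\<bar> \<le> W T \<omega>})) \<ge> ereal (1 - \<alpha>)"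
  unfolding le_Liminf_iff
proof (intro allI impI)
  fix c assume c: "c < ereal (1 - \<alpha>)"
  let ?N = std_normal_distribution and ?w = "\<bar>normal_quantile (\<alpha> / 2)\<bar>"
  interpret N: real_distribution ?N by (rule real_dist_normal_dist)
  obtain m where m: "c < ereal m" "m < 1 - \<alpha>" using ereal_dense2[OF c] by auto
  \<comment> \<open>The interval is shrunk to leave room for the perturbations of the centre and of
    the width, but so little that its mass stays above \<open>m\<close>.\<close>
  obtain k where k: "measure ?N {x. \<bar>x\<bar> \<le> ?w - 1 / real (Suc k)} > m"
  proof -
    define B where "B k = {x. \<bar>x\<bar> \<le> ?w - 1 / real (Suc k)}" for k
    have "(\<lambda>k. measure ?N (B k)) \<longlonglongrightarrow> measure ?N (\<Union>k. B k)"
    proof (rule N.finite_Lim_measure_incseq)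
      show "incseq B"
      proof (rule incseq_SucI)
        fix k
        have "1 / real (Suc (Suc k)) \<le> 1 / real (Suc k)" by (simp add: field_simps)
        then show "B k \<subseteq> B (Suc k)" by (auto simp: B_def)
      qed
    qed (auto simp: B_def)
    also have "(\<Union>k. B k) = {x. \<bar>x\<bar> < ?w}"
    proof (intro subset_antisym subsetI)
      fix x assume "x \<in> {x. \<bar>x\<bar> < ?w}"
      then obtain k where "inverse (real (Suc k)) < ?w - \<bar>x\<bar>"
        using reals_Archimedean[of "?w - \<bar>x\<bar>"] by auto
      then have "x \<in> B k" by (simp add: B_def field_simps)
      then show "x \<in> (\<Union>k. B k)" by blast
    next
      fix x assume "x \<in> (\<Union>k. B k)"
      then obtain k where "\<bar>x\<bar> \<le> ?w - 1 / real (Suc k)" by (auto simp: B_def)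
      moreover have "1 / real (Suc k) > 0" by simp
      ultimately show "x \<in> {x. \<bar>x\<bar> < ?w}" unfolding mem_Collect_eq by linarith
    qed
    finally have "(\<lambda>k. measure ?N (B k)) \<longlonglongrightarrow> measure ?N {x. \<bar>x\<bar> < ?w}" .
    moreover have "m < measure ?N {x. \<bar>x\<bar> < ?w}"
      using std_normal_symmetric_interval[of "\<alpha> / 2"] \<alpha> m by simp
    ultimately have "\<forall>\<^sub>F k in sequentially. m < measure ?N (B k)"
      by (rule order_tendstoD)
    then show thesis using that by (auto simp: B_def eventually_sequentially)
  qed
  \<comment> \<open>\<delta> is the shrinkage on the scale of \<open>U\<close>, shared equally
    between \<open>V\<close> and \<open>W\<close>. \<eta> is half of the surplus mass, so removing
    an event of probability \<eta> still leaves more than \<open>m\<close>.\<close>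
  define \<delta> where "\<delta> = s / real (Suc k)"
  define \<eta> where "\<eta> = (measure ?N {x. \<bar>x\<bar> \<le> ?w - 1 / real (Suc k)} - m) / 2"
  have \<delta>: "\<delta> / 2 > 0" and \<eta>: "\<eta> > 0" using s k by (auto simp: \<delta>_def \<eta>_def)
  let ?G = "\<lambda>T. {\<omega> \<in> space M. \<bar>U T \<omega>\<bar> \<le> ?w * s - \<delta>}"
  have U: "U T \<in> borel_measurable M" for T
    using normal[of T] by (auto simp: distributed_def)
  have G: "?G T \<in> events" for T using U[of T] by measurable
  have PG: "prob (?G T) = measure ?N {x. \<bar>x\<bar> \<le> ?w - 1 / real (Suc k)}" for T
  proof -
    have "distributed M lborel (\<lambda>\<omega>. (U T \<omega> - 0) / s) std_normal_density"
      using normal_standard_normal_convert[OF s, of "U T" 0] normal[of T] by blast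
    then have "?N = distr M lborel (\<lambda>\<omega>. U T \<omega> / s)" by (simp add: distributed_def)
    then have "measure ?N {x. \<bar>x\<bar> \<le> ?w - 1 / real (Suc k)}
        = prob ((\<lambda>\<omega>. U T \<omega> / s) -` {x. \<bar>x\<bar> \<le> ?w - 1 / real (Suc k)} \<inter> space M)"
      using U by (simp add: measure_distr)
    also have "(\<lambda>\<omega>. U T \<omega> / s) -` {x. \<bar>x\<bar> \<le> ?w - 1 / real (Suc k)} \<inter> space M = ?G T"
      using s by (auto simp: \<delta>_def abs_divide pos_divide_le_eq left_diff_distrib)
    finally show ?thesis by simp
  qed
  have "eventually (\<lambda>p. dist (V (fst p) (snd p)) 0 < \<delta> / 2 \<and>
      dist (W (fst p) (snd p)) (?w * s) < \<delta> / 2) (whp M)"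
    using tendstoD[OF V \<delta>] tendstoD[OF W \<delta>] by (rule eventually_conj)
  then have "\<forall>\<^sub>F T in sequentially. \<exists>E\<in>events. prob E \<ge> 1 - \<eta> \<and> (\<forall>\<omega>\<in>E.
      dist (V T \<omega>) 0 < \<delta> / 2 \<and> dist (W T \<omega>) (?w * s) < \<delta> / 2)"
    using \<eta> unfolding eventually_whp by simp
  then show "\<forall>\<^sub>F T in sequentially. c < ereal (prob {\<omega> \<in> space M. \<bar>U T \<omega> + V T \<omega>\<bar> \<le> W T \<omega>})"
  proof eventually_elim
    case (elim T)
    then obtain E where E: "E \<in> events" "prob E \<ge> 1 - \<eta>"
      "\<And>\<omega>. \<omega> \<in> E \<Longrightarrow> \<bar>V T \<omega>\<bar> < \<delta> / 2 \<and> \<bar>W T \<omega> - ?w * s\<bar> < \<delta> / 2"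
      by (auto simp: dist_real_def)
    have sub: "?G T \<inter> E \<subseteq> {\<omega> \<in> space M. \<bar>U T \<omega> + V T \<omega>\<bar> \<le> W T \<omega>}"
    proof
      fix \<omega> assume "\<omega> \<in> ?G T \<inter> E"
      then have "\<omega> \<in> space M" "\<bar>U T \<omega>\<bar> \<le> ?w * s - \<delta>" "\<omega> \<in> E" by auto
      moreover from this E(3)[of \<omega>] have "\<bar>U T \<omega> + V T \<omega>\<bar> \<le> W T \<omega>" by linarith
      ultimately show "\<omega> \<in> {\<omega> \<in> space M. \<bar>U T \<omega> + V T \<omega>\<bar> \<le> W T \<omega>}" by simp
    qed
    have "m < P - (P - m) / 2" if "m < P" for P :: real using that by (simp add: field_simps)
    from this[OF k] have "m < prob (?G T) - \<eta>" by (simp only: PG \<eta>_def)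
    also have "\<dots> \<le> prob (?G T \<inter> E)"
      using large_event_Int[OF G[of T] E(1), of "1 - prob (?G T)" \<eta>] E(2) by simp
    also have "\<dots> \<le> prob {\<omega> \<in> space M. \<bar>U T \<omega> + V T \<omega>\<bar> \<le> W T \<omega>}"
      using sub meas by (rule finite_measure_mono)
    finally show ?case using m(1) by (auto intro: less_trans)
  qed
qed

end

section \<open>Estimation errors\<close>

lemma sum_Plus_UNIV:
  fixes f :: "'a::finite + 'b::finite \<Rightarrow> 'c::comm_monoid_add"
  shows "(\<Sum>i\<in>UNIV. f i) = (\<Sum>i\<in>UNIV. f (Inl i)) + (\<Sum>i\<in>UNIV. f (Inr i))"
  by (subst UNIV_Plus_UNIV[symmetric], subst sum.Plus) (auto simp: comp_def)

lemma inner_block_vec: "block_vec c u \<bullet> block_vec c' u' = c * c' + u \<bullet> u'"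
  by (simp add: block_vec_def inner_vec_def sum_Plus_UNIV)

lemma block_mat_mult_block_vec:
  "block_mat s u S *v block_vec c v = block_vec (s * c + u \<bullet> v) (c *\<^sub>R u + S *v v)"
  by (simp add: block_vec_def block_mat_def inner_vec_def matrix_vector_mult_def sum_Plus_UNIV
      vec_eq_iff mult.commute split: sum.splits)

text \<open>By the first-row recursion every such entry is a polynomial in the coefficients. All
  columns \<open>j\<close> are needed for the induction, although only the corner entry is used
  later.\<close>

lemma tendsto_companion_pow:
  assumes a: "\<And>l. l \<in> {1..q} \<Longrightarrow> ((\<lambda>p. ah p l) \<longlongrightarrow> a l) F" and j: "j < q"
  shows "((\<lambda>p. (companion q (ah p) ^\<^sub>m m) $$ (0, j)) \<longlongrightarrow> (companion q a ^\<^sub>m m) $$ (0, j)) F"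
  using j
proof (induction m arbitrary: j)
  case 0
  then show ?case by (simp add: companion_pow_row_0 del: pow_mat.simps)
next
  case (Suc m)
  then have "((\<lambda>p. if Suc j < q then (companion q (ah p) ^\<^sub>m m) $$ (0, Suc j) else 0) \<longlongrightarrow>
      (if Suc j < q then (companion q a ^\<^sub>m m) $$ (0, Suc j) else 0)) F"
    by auto
  then show ?case
    unfolding companion_pow_row_Suc[OF Suc.prems]
    using Suc by (intro tendsto_intros a) auto
qed

lemma measurable_companion_pow:
  assumes a: "\<And>l. l \<in> {1..q} \<Longrightarrow> (\<lambda>\<omega>. ah \<omega> l) \<in> borel_measurable M" and j: "j < q"
  shows "(\<lambda>\<omega>. (companion q (ah \<omega>) ^\<^sub>m m) $$ (0, j)) \<in> borel_measurable M"
  using j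
proof (induction m arbitrary: j)
  case 0
  then show ?case by (simp add: companion_pow_row_0 del: pow_mat.simps)
next
  case (Suc m)
  have "(\<lambda>\<omega>. if Suc j < q then (companion q (ah \<omega>) ^\<^sub>m m) $$ (0, Suc j) else 0) \<in> borel_measurable M"
    using Suc by (cases "Suc j < q") auto
  then show ?case
    unfolding companion_pow_row_Suc[OF Suc.prems]
    using Suc by (intro borel_measurable_add borel_measurable_times a) auto
qed

lemma measurable_matrix_vector_mult:
  fixes A :: "'w \<Rightarrow> real ^ 'n::finite ^ 'm::finite"
  assumes "A \<in> borel_measurable M" "x \<in> borel_measurable M"
  shows "(\<lambda>\<omega>. A \<omega> *v x \<omega>) \<in> borel_measurable M"
proof -
  have "continuous_on UNIV (\<lambda>p :: (real ^ 'n ^ 'm) \<times> (real ^ 'n). fst p *v snd p)"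
    unfolding matrix_vector_mult_def by (intro continuous_intros continuous_on_vec_lambda)
  from borel_measurable_continuous_on[OF this borel_measurable_Pair[OF assms]] show ?thesis
    by simp
qed

lemma measurable_filtered:
  assumes "\<And>l. l \<in> {1..q} \<Longrightarrow> (\<lambda>\<omega>. A \<omega> l) \<in> borel_measurable M"
    and "\<And>t. y t \<in> borel_measurable M"
  shows "(\<lambda>\<omega>. filtered q (A \<omega>) (\<lambda>t. y t \<omega>) t) \<in> borel_measurable M"
  unfolding filtered_def using assms
  by (intro borel_measurable_diff borel_measurable_sum measurable_matrix_vector_mult) auto

text \<open>The one product of two estimates is split as \<open>\<gamma>h \<bullet> Dh - \<gamma>
  \<bullet> D = (\<gamma>h - \<gamma>) \<bullet> D + \<gamma>h \<bullet> (Dh - D)\<close>. In this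
  way the error of \<gamma> meets the true \<open>D\<close>, the one whose size is controlled, and
  the error of \<open>A\<close> meets \<open>yS\<close>, at the price of the factor
  \<open>norm \<gamma>h\<close>.\<close>

lemma residual_error_bound:
  fixes y :: "int \<Rightarrow> real"
  assumes model: "y t = (\<Sum>l=1..q1. a l * y (t - int l)) + z t \<bullet> \<theta> + x t \<bullet> \<delta>
      + \<gamma> \<bullet> filtered q2 A yS t + e"
  shows "\<bar>residual q1 y z x (filtered q2 Ah yS) (ah, \<theta>h, \<delta>h, \<gamma>h) t - e\<bar> \<le>
    (\<Sum>l=1..q1. \<bar>ah l - a l\<bar> * \<bar>y (t - int l)\<bar>) + norm (\<theta>h - \<theta>) * norm (z t)
      + norm (\<delta>h - \<delta>) * norm (x t) + norm (\<gamma>h - \<gamma>) * norm (filtered q2 A yS t)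
      + (\<Sum>l=1..q2. (norm \<gamma>h * norm (Ah l - A l)) * norm (yS (t - int l)))"
proof -
  let ?S = "\<Sum>l=1..q1. (ah l - a l) * y (t - int l)"
  let ?G = "\<Sum>l=1..q2. \<gamma>h \<bullet> ((Ah l - A l) *v yS (t - int l))"
  have D: "filtered q2 Ah yS t = filtered q2 A yS t - (\<Sum>l=1..q2. (Ah l - A l) *v yS (t - int l))"
    by (simp add: filtered_def matrix_vector_mult_diff_rdistrib sum_subtractf)
  have "residual q1 y z x (filtered q2 Ah yS) (ah, \<theta>h, \<delta>h, \<gamma>h) t - e =
      - ?S - (\<theta>h - \<theta>) \<bullet> z t - (\<delta>h - \<delta>) \<bullet> x t - (\<gamma>h - \<gamma>) \<bullet> filtered q2 A yS t + ?G"
    unfolding residual_def prod.case using model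
    by (simp add: D inner_diff_left inner_diff_right inner_sum_right left_diff_distrib
        sum_subtractf inner_commute)
  also have "\<bar>\<dots>\<bar> \<le> \<bar>?S\<bar> + \<bar>(\<theta>h - \<theta>) \<bullet> z t\<bar> + \<bar>(\<delta>h - \<delta>) \<bullet> x t\<bar>
      + \<bar>(\<gamma>h - \<gamma>) \<bullet> filtered q2 A yS t\<bar> + \<bar>?G\<bar>"
    by linarith
  also have "\<dots> \<le> (\<Sum>l=1..q1. \<bar>ah l - a l\<bar> * \<bar>y (t - int l)\<bar>) + norm (\<theta>h - \<theta>) * norm (z t)
      + norm (\<delta>h - \<delta>) * norm (x t) + norm (\<gamma>h - \<gamma>) * norm (filtered q2 A yS t)
      + (\<Sum>l=1..q2. (norm \<gamma>h * norm (Ah l - A l)) * norm (yS (t - int l)))"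
  proof (intro add_mono Cauchy_Schwarz_ineq2)
    show "\<bar>?S\<bar> \<le> (\<Sum>l=1..q1. \<bar>ah l - a l\<bar> * \<bar>y (t - int l)\<bar>)"
      by (rule order_trans[OF sum_abs]) (simp add: abs_mult)
    show "\<bar>?G\<bar> \<le> (\<Sum>l=1..q2. (norm \<gamma>h * norm (Ah l - A l)) * norm (yS (t - int l)))"
    proof (rule order_trans[OF sum_abs], rule sum_mono)
      fix l
      have "\<bar>\<gamma>h \<bullet> ((Ah l - A l) *v yS (t - int l))\<bar>
          \<le> norm \<gamma>h * norm ((Ah l - A l) *v yS (t - int l))"
        by (rule Cauchy_Schwarz_ineq2)
      also have "\<dots> \<le> norm \<gamma>h * (norm (Ah l - A l) * norm (yS (t - int l)))"
        by (intro mult_left_mono norm_matrix_vector_mult_le) auto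
      finally show "\<bar>\<gamma>h \<bullet> ((Ah l - A l) *v yS (t - int l))\<bar>
          \<le> (norm \<gamma>h * norm (Ah l - A l)) * norm (yS (t - int l))"
        by (simp add: mult.assoc)
    qed
  qed
  finally show ?thesis .
qed

text \<open>Forecast and residual use the same coefficients and the same inputs, so their exogenous
  parts cancel. What remains is an autoregression in the estimated coefficients, driven by the
  residuals and started at zero because forecasts up to \<open>T\<close> are the data.\<close>

lemma forecast_error:
  fixes y :: "int \<Rightarrow> real"
  assumes q: "q \<ge> 1"
  shows "y (int T + int h) - forecast q T y z x D (a, \<theta>, \<delta>, \<gamma>) (int T + int h) =
    (\<Sum>r<h. (companion q a ^\<^sub>m r) $$ (0, 0)
      * residual q y z x D (a, \<theta>, \<delta>, \<gamma>) (int T + int h - int r))"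
proof (rule autoregression_expansion[OF q, where d = "\<lambda>t. y t - forecast q T y z x D (a, \<theta>, \<delta>, \<gamma>) t"])
  fix t assume "t \<le> int T"
  then show "y t - forecast q T y z x D (a, \<theta>, \<delta>, \<gamma>) t = 0" by (simp add: forecast.simps)
next
  fix t assume "t > int T"
  then show "y t - forecast q T y z x D (a, \<theta>, \<delta>, \<gamma>) t =
      (\<Sum>l=1..q. a l * (y (t - int l) - forecast q T y z x D (a, \<theta>, \<delta>, \<gamma>) (t - int l)))
        + residual q y z x D (a, \<theta>, \<delta>, \<gamma>) t"
    by (subst forecast.simps) (simp add: residual_def right_diff_distrib sum_subtractf)
qed

text \<open>The normalisation is that of the variance estimator, so the squared value at the
  residuals is exactly \<open>variance_hat\<close> once \<open>T > q\<close>.\<close>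

definition rms :: "nat \<Rightarrow> nat \<Rightarrow> (int \<Rightarrow> real) \<Rightarrow> real" where
  "rms q T f = L2_set f {int q + 1..int T} / sqrt (real T - real q)"

lemma rms_triangle: "T > q \<Longrightarrow> rms q T (\<lambda>t. f t + g t) \<le> rms q T f + rms q T g"
  unfolding rms_def add_divide_distrib[symmetric]
  by (intro divide_right_mono L2_set_triangle_ineq) auto

lemma rms_cmult: "c \<ge> 0 \<Longrightarrow> rms q T (\<lambda>t. c * f t) = c * rms q T f"
  by (simp add: rms_def L2_set_right_distrib)

lemma rms_sum_le:
  assumes "T > q" "finite I"
  shows "rms q T (\<lambda>t. \<Sum>i\<in>I. f i t) \<le> (\<Sum>i\<in>I. rms q T (f i))"
  using assms(2)
proof (induction I)
  case empty
  then show ?case by (simp add: rms_def L2_set_def)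
next
  case (insert i I)
  then show ?case
    using rms_triangle[OF assms(1), of "f i" "\<lambda>t. \<Sum>i\<in>I. f i t"] by simp
qed

lemma rms_mono:
  assumes "T > q" "\<And>t. \<bar>f t\<bar> \<le> g t"
  shows "rms q T f \<le> rms q T g"
proof -
  have "rms q T f = rms q T (\<lambda>t. \<bar>f t\<bar>)" by (simp add: rms_def L2_set_def)
  also have "\<dots> \<le> rms q T g"
    unfolding rms_def using assms by (intro divide_right_mono L2_set_mono) auto
  finally show ?thesis .
qed

lemma rms_sq:
  assumes "T > q"
  shows "(rms q T f)\<^sup>2 = (\<Sum>t\<in>{int q + 1..int T}. (f t)\<^sup>2) / (real T - real q)"
  using assms by (simp add: rms_def L2_set_def power_divide sum_nonneg)

lemma rms_diff_le:
  assumes "T > q"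
  shows "\<bar>rms q T f - rms q T g\<bar> \<le> rms q T (\<lambda>t. f t - g t)"
  using rms_triangle[OF assms, of "\<lambda>t. f t - g t" g] rms_triangle[OF assms, of "\<lambda>t. g t - f t" f]
  by (simp add: rms_def L2_set_def power2_commute)

text \<open>Each \<open>t \<ge> 1\<close> is in the range of every later maximum, so the eventual
  bound holds for all \<open>t\<close>. In particular it covers times such as \<open>T + j\<close>
  beyond the sample.\<close>

lemma Max_bigo_1_bounded:
  fixes f :: "int \<Rightarrow> real"
  assumes "(\<lambda>T. Max (f ` {1..int T})) \<in> O(\<lambda>_. 1)"
  shows "\<exists>C. \<forall>t\<ge>1. f t \<le> C"
proof -
  obtain C where "\<forall>\<^sub>F T in sequentially. norm (Max (f ` {1..int T})) \<le> C * norm (1::real)"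
    using assms by (auto elim: landau_o.bigE)
  then obtain N where N: "\<And>T. T \<ge> N \<Longrightarrow> \<bar>Max (f ` {1..int T})\<bar> \<le> C"
    by (auto simp: eventually_sequentially)
  have "f t \<le> C" if "t \<ge> 1" for t
  proof -
    let ?T = "max N (nat t)"
    have "f t \<le> Max (f ` {1..int ?T})" using that by (intro Max_ge) auto
    then show ?thesis using N[of ?T] by simp
  qed
  then show ?thesis by blast
qed

lemma le_one_plus_square: "u \<le> 1 + u\<^sup>2" for u :: real
proof -
  have "0 \<le> (u - 1)\<^sup>2" "0 \<le> u\<^sup>2" by auto
  moreover have "(u - 1)\<^sup>2 = u\<^sup>2 - 2 * u + 1" by (simp add: power2_eq_square algebra_simps)
  ultimately show ?thesis by linarith
qed

section \<open>Stochastic size of the regressors and of their products with estimation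
  errors\<close>

context prob_space
begin

lemma second_moment_bound:
  fixes X :: "'a \<Rightarrow> real"
  assumes "integrable M (\<lambda>\<omega>. X \<omega> ^ 4)" "integrable M (\<lambda>\<omega>. (X \<omega>)\<^sup>2)"
    and "expectation (\<lambda>\<omega>. X \<omega> ^ 4) \<le> C"
  shows "expectation (\<lambda>\<omega>. (X \<omega>)\<^sup>2) \<le> 1 + C"
proof -
  have "expectation (\<lambda>\<omega>. (X \<omega>)\<^sup>2) \<le> expectation (\<lambda>\<omega>. 1 + X \<omega> ^ 4)"
    using assms le_one_plus_square[of "(X _)\<^sup>2"] by (intro integral_mono) auto
  also have "\<dots> = 1 + expectation (\<lambda>\<omega>. X \<omega> ^ 4)" using assms by (simp add: prob_space)
  finally show ?thesis using assms(3) by simp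
qed

lemma bounded_in_prob_sqD:
  assumes "bounded_in_prob M (\<lambda>p. (X p)\<^sup>2)"
  shows "bounded_in_prob M X"
proof (rule bounded_in_prob_mono[OF bounded_in_prob_add[OF assms bounded_in_prob_const[of 1]]])
  have "\<bar>u\<bar> \<le> \<bar>u\<^sup>2 + 1\<bar>" for u :: real
    using le_one_plus_square[of "\<bar>u\<bar>"] by simp
  then show "\<forall>\<^sub>F T in sequentially. \<forall>\<omega>\<in>space M. \<bar>X (T, \<omega>)\<bar> \<le> \<bar>(X (T, \<omega>))\<^sup>2 + 1\<bar>"
    by simp
qed

text \<open>The first claim is for times around the forecast origin, the second for averages over
  the sample. The condition \<open>l \<le> q\<close> keeps the lagged times at or after 1, where the
  moment bounds hold.\<close>

lemma bounded_in_prob_moments: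
  fixes Y :: "int \<Rightarrow> 'a \<Rightarrow> real"
  assumes int: "\<And>t. t \<ge> 1 \<Longrightarrow> integrable M (\<lambda>\<omega>. (Y t \<omega>)\<^sup>2)"
    and C: "\<And>t. t \<ge> 1 \<Longrightarrow> expectation (\<lambda>\<omega>. (Y t \<omega>)\<^sup>2) \<le> C"
  shows "bounded_in_prob M (\<lambda>p. Y (int (fst p) + k) (snd p))"
    and "l \<le> q \<Longrightarrow> bounded_in_prob M (\<lambda>p. rms q (fst p) (\<lambda>t. Y (t - int l) (snd p)))"
proof -
  have "\<forall>\<^sub>F T in sequentially. integrable M (\<lambda>\<omega>. (Y (int T + k) \<omega>)\<^sup>2)
      \<and> expectation (\<lambda>\<omega>. (Y (int T + k) \<omega>)\<^sup>2) \<le> C"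
    using eventually_ge_at_top[of "nat (1 - k)"] by eventually_elim (auto intro: int C)
  then have "bounded_in_prob M (\<lambda>p. (Y (int (fst p) + k) (snd p))\<^sup>2)"
    by (rule bounded_in_prob_expectation) auto
  then show "bounded_in_prob M (\<lambda>p. Y (int (fst p) + k) (snd p))" by (rule bounded_in_prob_sqD)
next
  assume l: "l \<le> q"
  \<comment> \<open>The absolute value makes the quotient nonnegative for every \<open>T\<close>, as
    \<open>bounded_in_prob_expectation\<close> demands; it has no effect once
    \<open>T > q\<close>.\<close>
  let ?X = "\<lambda>T \<omega>. (\<Sum>t\<in>{int q + 1..int T}. (Y (t - int l) \<omega>)\<^sup>2) / \<bar>real T - real q\<bar>"
  have "bounded_in_prob M (\<lambda>p. ?X (fst p) (snd p))"
  proof (rule bounded_in_prob_expectation)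
    show "\<forall>\<^sub>F T in sequentially. integrable M (?X T) \<and> expectation (?X T) \<le> C"
      using eventually_gt_at_top[of q]
    proof eventually_elim
      case (elim T)
      have i: "integrable M (\<lambda>\<omega>. (Y (t - int l) \<omega>)\<^sup>2)" if "t \<in> {int q + 1..int T}" for t
        using that l by (intro int) auto
      have "expectation (?X T) = (\<Sum>t\<in>{int q + 1..int T}. expectation (\<lambda>\<omega>. (Y (t - int l) \<omega>)\<^sup>2))
          / (real T - real q)"
        using elim i by (simp add: integral_sum)
      also have "\<dots> \<le> (\<Sum>t\<in>{int q + 1..int T}. C) / (real T - real q)"
        using elim l by (intro divide_right_mono sum_mono C) auto
      also have "(\<Sum>t\<in>{int q + 1..int T}. C) = (real T - real q) * C"
        using elim by (simp add: of_nat_nat)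
      finally have "expectation (?X T) \<le> C" using elim by simp
      moreover have "integrable M (?X T)"
        by (intro integrable_divide Bochner_Integration.integrable_sum i)
      ultimately show ?case by blast
    qed
  qed (auto intro!: divide_nonneg_nonneg sum_nonneg)
  then have "bounded_in_prob M (\<lambda>p. (rms q (fst p) (\<lambda>t. Y (t - int l) (snd p)))\<^sup>2)"
  proof (rule bounded_in_prob_mono)
    show "\<forall>\<^sub>F T in sequentially. \<forall>\<omega>\<in>space M.
        \<bar>(rms q (fst (T, \<omega>)) (\<lambda>t. Y (t - int l) (snd (T, \<omega>))))\<^sup>2\<bar> \<le> \<bar>?X (fst (T, \<omega>)) (snd (T, \<omega>))\<bar>"
      using eventually_gt_at_top[of q] by eventually_elim (simp add: rms_sq)
  qed
  then show "bounded_in_prob M (\<lambda>p. rms q (fst p) (\<lambda>t. Y (t - int l) (snd p)))"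
    by (rule bounded_in_prob_sqD)
qed

lemma rms_smallo_of_lambda_max:
  fixes v :: "int \<Rightarrow> 'a \<Rightarrow> real ^ 'n::finite"
  assumes meas: "\<And>t. v t \<in> borel_measurable M"
    and eig: "smallo_prob M (\<lambda>T \<omega>. lambda_max (mean_outer q T (\<lambda>t. v t \<omega>))) (\<lambda>T. (\<zeta> T)\<^sup>2)"
    and \<zeta>: "filterlim \<zeta> at_top sequentially"
  shows "((\<lambda>p. rms q (fst p) (\<lambda>t. norm (v t (snd p))) / \<zeta> (fst p)) \<longlongrightarrow> 0) (whp M)"
proof -
  let ?L = "\<lambda>T \<omega>. lambda_max (mean_outer q T (\<lambda>t. v t \<omega>))"
  have \<zeta>0: "\<forall>\<^sub>F T in sequentially. \<zeta> T > 0" using \<zeta> by (auto simp: filterlim_at_top_dense)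
  have "((\<lambda>p. ?L (fst p) (snd p) / (\<zeta> (fst p))\<^sup>2) \<longlongrightarrow> 0) (whp M)"
    using \<zeta>0 by (intro smallo_probD[OF lambda_max_mean_outer_measurable[OF meas] eig])
      (auto elim: eventually_mono)
  \<comment> \<open>The factor 2 compares the normalisation \<open>T - q\<close> of
    \<open>rms\<close> with the \<open>T\<close> of \<open>mean_outer\<close>, valid for
    \<open>T \<ge> 2 * q\<close>; the cardinality comes from the trace bound.\<close>
  then have "((\<lambda>p. sqrt (2 * real CARD('n) * (?L (fst p) (snd p) / (\<zeta> (fst p))\<^sup>2)))
      \<longlongrightarrow> sqrt (2 * real CARD('n) * 0)) (whp M)"
    by (intro tendsto_intros)
  then have lim: "((\<lambda>p. sqrt (2 * real CARD('n) * (?L (fst p) (snd p) / (\<zeta> (fst p))\<^sup>2))) \<longlongrightarrow> 0) (whp M)"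
    by simp
  have "\<forall>\<^sub>F T in sequentially. \<forall>\<omega>\<in>space M.
      norm (rms q (fst (T, \<omega>)) (\<lambda>t. norm (v t (snd (T, \<omega>)))) / \<zeta> (fst (T, \<omega>)))
      \<le> sqrt (2 * real CARD('n) * (?L (fst (T, \<omega>)) (snd (T, \<omega>)) / (\<zeta> (fst (T, \<omega>)))\<^sup>2))"
    using \<zeta>0 eventually_gt_at_top[of "2 * q + 1"]
  proof eventually_elim
    case (elim T)
    show ?case
    proof
      fix \<omega>
      let ?R = "rms q T (\<lambda>t. norm (v t \<omega>))" and ?S = "\<Sum>t\<in>{int q + 1..int T}. (norm (v t \<omega>))\<^sup>2"
      have T: "T > q" "real T - real q \<ge> real T / 2" "real T > 0" using elim(2) by auto
      have "?R\<^sup>2 = ?S / (real T - real q)" using T by (intro rms_sq)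
      also have "\<dots> \<le> ?S / (real T / 2)" using T by (intro divide_left_mono sum_nonneg) auto
      also have "\<dots> = 2 * (?S / real T)" by simp
      also have "\<dots> \<le> 2 * (real CARD('n) * ?L T \<omega>)"
        by (intro mult_left_mono mean_norm_sq_le_lambda_max) auto
      finally have "(?R / \<zeta> T)\<^sup>2 \<le> 2 * real CARD('n) * (?L T \<omega> / (\<zeta> T)\<^sup>2)"
        using elim(1) by (simp add: power_divide divide_right_mono)
      then have "\<bar>?R / \<zeta> T\<bar> \<le> sqrt (2 * real CARD('n) * (?L T \<omega> / (\<zeta> T)\<^sup>2))"
        by (metis real_sqrt_abs real_sqrt_le_iff)
      then show "norm (rms q (fst (T, \<omega>)) (\<lambda>t. norm (v t (snd (T, \<omega>)))) / \<zeta> (fst (T, \<omega>)))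
          \<le> sqrt (2 * real CARD('n) * (?L (fst (T, \<omega>)) (snd (T, \<omega>)) / (\<zeta> (fst (T, \<omega>)))\<^sup>2))"
        by simp
    qed
  qed
  then show ?thesis by (rule Lim_null_comparison[OF eventually_whpI lim])
qed

lemma bigO_prob_inverse_mult_tendsto_0:
  assumes "\<And>T. X T \<in> borel_measurable M" "bigO_prob M X (\<lambda>T. inverse (\<zeta> T))"
    and \<zeta>: "filterlim \<zeta> at_top sequentially"
    and Y: "((\<lambda>p. Y p / \<zeta> (fst p)) \<longlongrightarrow> 0) (whp M)"
  shows "((\<lambda>p. X (fst p) (snd p) * Y p) \<longlongrightarrow> 0) (whp M)"
proof -
  have \<zeta>0: "\<forall>\<^sub>F T in sequentially. \<zeta> T > 0" using \<zeta> by (auto simp: filterlim_at_top_dense)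
  have "((\<lambda>p. (\<zeta> (fst p) * X (fst p) (snd p)) * (Y p / \<zeta> (fst p))) \<longlongrightarrow> 0) (whp M)"
    by (intro bounded_in_prob_mult_tendsto_0 bigO_probD assms \<zeta>0)
  moreover have "eventually (\<lambda>p. (\<zeta> (fst p) * X (fst p) (snd p)) * (Y p / \<zeta> (fst p))
      = X (fst p) (snd p) * Y p) (whp M)"
    using \<zeta>0 by (intro eventually_whpI) (auto elim: eventually_mono)
  ultimately show ?thesis by (rule Lim_transform_eventually)
qed

lemma bigO_prob_inverse_tendsto_0:
  assumes "\<And>T. X T \<in> borel_measurable M" "bigO_prob M X (\<lambda>T. inverse (\<zeta> T))"
    and \<zeta>: "filterlim \<zeta> at_top sequentially"
  shows "((\<lambda>p. X (fst p) (snd p)) \<longlongrightarrow> 0) (whp M)"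
proof -
  have "(\<lambda>T. 1 / \<zeta> T) \<longlonglongrightarrow> 0"
    using \<zeta> by (intro tendsto_divide_0[OF tendsto_const]) (rule filterlim_at_top_imp_at_infinity)
  from tendsto_whp_deterministic[OF this] show ?thesis
    using bigO_prob_inverse_mult_tendsto_0[OF assms, of "\<lambda>_. 1"] by simp
qed

end

lemma matrix_mult_matrix_inv:
  assumes "invertible A"
  shows "A ** matrix_inv A = mat 1"
  using someI_ex[OF assms[unfolded invertible_def]] unfolding matrix_inv_def by blast

lemma (in prob_space) Lim_null_comparison_whp:
  assumes "\<forall>\<^sub>F T in sequentially. \<forall>\<omega>\<in>space M. norm (f T \<omega>) \<le> g T \<omega>"
    and "((\<lambda>p. g (fst p) (snd p)) \<longlongrightarrow> 0) (whp M)"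
  shows "((\<lambda>p. f (fst p) (snd p)) \<longlongrightarrow> 0) (whp M)"
  using assms by (intro Lim_null_comparison[OF eventually_whpI assms(2)]) simp

lemma rms_residual_error_bound:
  fixes y :: "int \<Rightarrow> real"
  assumes T: "T > q1"
    and model: "\<And>t. y t = (\<Sum>l=1..q1. a l * y (t - int l)) + z t \<bullet> \<theta> + x t \<bullet> \<delta>
      + \<gamma> \<bullet> filtered q2 A yS t + e t"
  shows "rms q1 T (\<lambda>t. residual q1 y z x (filtered q2 Ah yS) (ah, \<theta>h, \<delta>h, \<gamma>h) t - e t) \<le>
    (\<Sum>l=1..q1. \<bar>ah l - a l\<bar> * rms q1 T (\<lambda>t. \<bar>y (t - int l)\<bar>))
      + norm (\<theta>h - \<theta>) * rms q1 T (\<lambda>t. norm (z t))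
      + norm (\<delta>h - \<delta>) * rms q1 T (\<lambda>t. norm (x t))
      + norm (\<gamma>h - \<gamma>) * rms q1 T (\<lambda>t. norm (filtered q2 A yS t))
      + (\<Sum>l=1..q2. (norm \<gamma>h * norm (Ah l - A l)) * rms q1 T (\<lambda>t. norm (yS (t - int l))))"
proof -
  let ?f1 = "\<lambda>t. \<Sum>l=1..q1. \<bar>ah l - a l\<bar> * \<bar>y (t - int l)\<bar>"
  let ?f2 = "\<lambda>t. norm (\<theta>h - \<theta>) * norm (z t)"
  let ?f3 = "\<lambda>t. norm (\<delta>h - \<delta>) * norm (x t)"
  let ?f4 = "\<lambda>t. norm (\<gamma>h - \<gamma>) * norm (filtered q2 A yS t)"
  let ?f5 = "\<lambda>t. \<Sum>l=1..q2. (norm \<gamma>h * norm (Ah l - A l)) * norm (yS (t - int l))"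
  have "rms q1 T (\<lambda>t. residual q1 y z x (filtered q2 Ah yS) (ah, \<theta>h, \<delta>h, \<gamma>h) t - e t)
      \<le> rms q1 T (\<lambda>t. ?f1 t + ?f2 t + ?f3 t + ?f4 t + ?f5 t)"
    using T by (rule rms_mono) (rule residual_error_bound[OF model])
  also have "\<dots> \<le> rms q1 T ?f1 + rms q1 T ?f2 + rms q1 T ?f3 + rms q1 T ?f4 + rms q1 T ?f5"
    using rms_triangle[OF T, of "\<lambda>t. ?f1 t + ?f2 t + ?f3 t + ?f4 t" ?f5]
      rms_triangle[OF T, of "\<lambda>t. ?f1 t + ?f2 t + ?f3 t" ?f4]
      rms_triangle[OF T, of "\<lambda>t. ?f1 t + ?f2 t" ?f3] rms_triangle[OF T, of ?f1 ?f2]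
    by linarith
  also have "rms q1 T ?f1 \<le> (\<Sum>l=1..q1. \<bar>ah l - a l\<bar> * rms q1 T (\<lambda>t. \<bar>y (t - int l)\<bar>))"
    using rms_sum_le[OF T, of "{1..q1}" "\<lambda>l t. \<bar>ah l - a l\<bar> * \<bar>y (t - int l)\<bar>"]
    by (simp add: rms_cmult)
  also have "rms q1 T ?f5 \<le>
      (\<Sum>l=1..q2. (norm \<gamma>h * norm (Ah l - A l)) * rms q1 T (\<lambda>t. norm (yS (t - int l))))"
    using rms_sum_le[OF T, of "{1..q2}" "\<lambda>l t. (norm \<gamma>h * norm (Ah l - A l)) * norm (yS (t - int l))"]
    by (simp add: rms_cmult)
  finally show ?thesis by (simp add: rms_cmult)
qed

text \<open>The eigenvalue conditions average over the sample and say nothing about a single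
  covariate at \<open>T + j\<close>, which is multiplied by an error of order
  \<open>1 / \<zeta>\<close>; hence the premises on future covariates in the coverage claim. For
  \<open>\<sigma>e2 = 0\<close> forecast error and interval width would both vanish in the limit,
  and consistency does not decide which is larger.\<close>

theorem theorem2:
  fixes M :: "'w measure"
    and q1 q2 :: nat
    and y :: "int \<Rightarrow> 'w \<Rightarrow> real" and yS :: "int \<Rightarrow> 'w \<Rightarrow> real ^ 'k::finite"
    and z :: "int \<Rightarrow> 'w \<Rightarrow> real ^ 'd::finite" and x :: "int \<Rightarrow> 'w \<Rightarrow> real ^ 'p::finite"
    and \<epsilon> :: "int \<Rightarrow> 'w \<Rightarrow> real" and \<epsilon>S :: "int \<Rightarrow> 'w \<Rightarrow> real ^ 'k"
    and a :: "nat \<Rightarrow> real" and \<theta> :: "real ^ 'd" and \<beta> :: "real ^ 'p"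
    and A :: "nat \<Rightarrow> real ^ 'k ^ 'k" and B :: "real ^ 'p ^ 'k"
    and \<sigma>TT2 :: real and \<Sigma>ST :: "real ^ 'k" and \<Sigma>SS :: "real ^ 'k ^ 'k"
    and \<gamma> :: "real ^ 'k" and \<delta> :: "real ^ 'p" and \<sigma>e2 :: real
    and Ahat :: "nat \<Rightarrow> 'w \<Rightarrow> nat \<Rightarrow> real ^ 'k ^ 'k" and Bhat :: "nat \<Rightarrow> 'w \<Rightarrow> real ^ 'p ^ 'k"
    and ahat :: "nat \<Rightarrow> 'w \<Rightarrow> nat \<Rightarrow> real" and \<theta>hat :: "nat \<Rightarrow> 'w \<Rightarrow> real ^ 'd"
    and \<delta>hat :: "nat \<Rightarrow> 'w \<Rightarrow> real ^ 'p" and \<gamma>hat :: "nat \<Rightarrow> 'w \<Rightarrow> real ^ 'k"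
    and Dhat :: "nat \<Rightarrow> 'w \<Rightarrow> int \<Rightarrow> real ^ 'k"
    and \<sigma>e2hat :: "nat \<Rightarrow> 'w \<Rightarrow> real" and yhat :: "nat \<Rightarrow> 'w \<Rightarrow> int \<Rightarrow> real"
    and \<zeta> :: "nat \<Rightarrow> real" and \<alpha> :: real
  assumes prob: "prob_space M"
    and orders: "q1 \<ge> q2" "q2 \<ge> 1"
    and level: "0 < \<alpha>" "\<alpha> < 1"
    and covariates: "\<And>t. z t \<in> borel_measurable M" "\<And>t. x t \<in> borel_measurable M"
    and M1: "\<And>t \<omega>. \<omega> \<in> space M \<Longrightarrow>
      y t \<omega> = (\<Sum>l=1..q1. a l * y (t - int l) \<omega>) + z t \<omega> \<bullet> \<theta> + x t \<omega> \<bullet> \<beta> + \<epsilon> t \<omega>"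
    and M2: "\<And>t \<omega>. \<omega> \<in> space M \<Longrightarrow>
      yS t \<omega> = (\<Sum>l=1..q2. A l *v yS (t - int l) \<omega>) + B *v x t \<omega> + \<epsilon>S t \<omega>"
    and M3_indep: "prob_space.indep_vars M (\<lambda>_. borel) (\<lambda>t \<omega>. block_vec (\<epsilon> t \<omega>) (\<epsilon>S t \<omega>)) UNIV"
    and M3_normal: "\<And>t. multivariate_normal M (\<lambda>\<omega>. block_vec (\<epsilon> t \<omega>) (\<epsilon>S t \<omega>)) 0
                          (block_mat \<sigma>TT2 \<Sigma>ST \<Sigma>SS)"
    and M3_inv: "invertible \<Sigma>SS"
    and \<gamma>_eq: "\<gamma> = matrix_inv \<Sigma>SS *v \<Sigma>ST"
    and \<sigma>e2_eq: "\<sigma>e2 = \<sigma>TT2 - \<Sigma>ST \<bullet> (matrix_inv \<Sigma>SS *v \<Sigma>ST)"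
    and \<delta>_eq: "\<delta> = \<beta> - Finite_Cartesian_Product.transpose B *v \<gamma>"
    and est_measurable:
      "\<And>T l. l \<in> {1..q2} \<Longrightarrow> (\<lambda>\<omega>. Ahat T \<omega> l) \<in> borel_measurable M"
      "\<And>T. Bhat T \<in> borel_measurable M"
      "\<And>T l. l \<in> {1..q1} \<Longrightarrow> (\<lambda>\<omega>. ahat T \<omega> l) \<in> borel_measurable M"
      "\<And>T. \<theta>hat T \<in> borel_measurable M"
      "\<And>T. \<delta>hat T \<in> borel_measurable M"
      "\<And>T. \<gamma>hat T \<in> borel_measurable M"
    and E1: "\<And>T \<omega>. \<omega> \<in> space M \<Longrightarrow>
      is_arg_min (loss1 q2 T (\<lambda>t. yS t \<omega>) (\<lambda>t. x t \<omega>)) (\<lambda>_. True) (Ahat T \<omega>, Bhat T \<omega>)"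
    and Dhat_eq: "\<And>T \<omega>. Dhat T \<omega> = filtered q2 (Ahat T \<omega>) (\<lambda>t. yS t \<omega>)"
    and E2: "\<And>T \<omega>. \<omega> \<in> space M \<Longrightarrow>
      is_arg_min (loss2 q1 T (\<lambda>t. y t \<omega>) (\<lambda>t. z t \<omega>) (\<lambda>t. x t \<omega>) (Dhat T \<omega>)) (\<lambda>_. True)
        (ahat T \<omega>, \<theta>hat T \<omega>, \<delta>hat T \<omega>, \<gamma>hat T \<omega>)"
    and \<sigma>e2hat_eq: "\<And>T \<omega>. \<sigma>e2hat T \<omega> =
      variance_hat q1 T (\<lambda>t. y t \<omega>) (\<lambda>t. z t \<omega>) (\<lambda>t. x t \<omega>) (Dhat T \<omega>)
        (ahat T \<omega>, \<theta>hat T \<omega>, \<delta>hat T \<omega>, \<gamma>hat T \<omega>)"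
    and yhat_eq: "\<And>T \<omega>. yhat T \<omega> =
      forecast q1 T (\<lambda>t. y t \<omega>) (\<lambda>t. z t \<omega>) (\<lambda>t. x t \<omega>) (Dhat T \<omega>)
        (ahat T \<omega>, \<theta>hat T \<omega>, \<delta>hat T \<omega>, \<gamma>hat T \<omega>)"
    and stationary_y: "stationary M y"
    and stationary_yS: "stationary M yS"
    and rate: "filterlim \<zeta> at_top sequentially"
    and consistent_E1:
      "\<And>l. l \<in> {1..q2} \<Longrightarrow> consistent M \<zeta> (\<lambda>T \<omega>. Ahat T \<omega> l) (A l)"
      "consistent M \<zeta> Bhat B"
    and consistent_E2:
      "consistent_coeffs M \<zeta> q1 ahat a"
      "consistent M \<zeta> \<theta>hat \<theta>"
      "consistent M \<zeta> \<delta>hat \<delta>"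
      "consistent M \<zeta> \<gamma>hat \<gamma>"
    and moments_y:
      "\<And>t. t \<ge> 1 \<Longrightarrow> integrable M (\<lambda>\<omega>. (y t \<omega>) ^ 4)"
      "(\<lambda>T. Max ((\<lambda>t. integral\<^sup>L M (\<lambda>\<omega>. (y t \<omega>) ^ 4)) ` {1..int T})) \<in> O(\<lambda>_. 1)"
    and moments_yS:
      "\<And>t. t \<ge> 1 \<Longrightarrow> integrable M (\<lambda>\<omega>. (norm (yS t \<omega>)) ^ 4)"
      "(\<lambda>T. Max ((\<lambda>t. integral\<^sup>L M (\<lambda>\<omega>. (norm (yS t \<omega>)) ^ 4)) ` {1..int T})) \<in> O(\<lambda>_. 1)"
    and eig_z: "smallo_prob M
      (\<lambda>T \<omega>. lambda_max (mean_outer q1 T (\<lambda>t. z t \<omega>))) (\<lambda>T. (\<zeta> T)\<^sup>2)"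
    and eig_x: "smallo_prob M
      (\<lambda>T \<omega>. lambda_max (mean_outer q1 T (\<lambda>t. x t \<omega>))) (\<lambda>T. (\<zeta> T)\<^sup>2)"
    and eig_D: "smallo_prob M
      (\<lambda>T \<omega>. lambda_max (mean_outer q1 T (filtered q2 A (\<lambda>t. yS t \<omega>)))) (\<lambda>T. (\<zeta> T)\<^sup>2)"
  shows "tendsto_in_prob M \<sigma>e2hat \<sigma>e2 \<and>
    (\<sigma>e2 > 0 \<longrightarrow>
     (\<forall>h\<ge>1.
          (\<forall>j\<in>{1..h}. smallo_prob M (\<lambda>T \<omega>. norm (z (int (T + j)) \<omega>)) \<zeta> \<and>
                    smallo_prob M (\<lambda>T \<omega>. norm (x (int (T + j)) \<omega>)) \<zeta>) \<longrightarrow>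
       liminf (\<lambda>T. ereal (measure M {\<omega> \<in> space M.
          y (int (T + h)) \<omega> \<in>
            BJ_interval q1 (ahat T \<omega>) (sqrt (\<sigma>e2hat T \<omega>)) \<alpha> h (yhat T \<omega> (int (T + h)))}))
        \<ge> ereal (1 - \<alpha>)))"
proof -
  interpret prob_space M by (rule prob)
  have q1: "q1 \<ge> 1" using orders by simp
  have \<zeta>0: "\<forall>\<^sub>F T in sequentially. \<zeta> T > 0" using rate by (auto simp: filterlim_at_top_dense)

  \<comment> \<open>The innovation and its law\<close>
  define e where "e t \<omega> = \<epsilon> t \<omega> - \<gamma> \<bullet> \<epsilon>S t \<omega>" for t \<omega>
  \<comment> \<open>The innovation is a linear functional of the joint noise, so it inherits
    normality and independence. The equation \<open>\<Sigma>SS *v \<gamma> = \<Sigma>ST\<close>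
    makes the lower block of \<open>?\<Sigma> *v ?u\<close> vanish, which leaves the Schur
    complement as its variance.\<close>
  let ?u = "block_vec 1 (- \<gamma>)" and ?\<Sigma> = "block_mat \<sigma>TT2 \<Sigma>ST \<Sigma>SS"
  have e_inner: "e t \<omega> = ?u \<bullet> block_vec (\<epsilon> t \<omega>) (\<epsilon>S t \<omega>)" for t \<omega>
    by (simp add: e_def inner_block_vec)
  have "\<Sigma>SS *v \<gamma> = \<Sigma>ST"
    unfolding \<gamma>_eq using matrix_mult_matrix_inv[OF M3_inv]
    by (simp add: matrix_vector_mul_assoc)
  then have e_var: "?u \<bullet> (?\<Sigma> *v ?u) = \<sigma>e2"
    by (simp add: block_mat_mult_block_vec inner_block_vec \<sigma>e2_eq \<gamma>_eq[symmetric] inner_add_right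
        inner_commute linear_neg[OF matrix_vector_mul_linear])
  have \<sigma>e2_nonneg: "\<sigma>e2 \<ge> 0"
    using M3_normal[of 0] unfolding multivariate_normal_def e_var[symmetric] by blast
  have e_law: "distr M borel (e t) = normal_law 0 \<sigma>e2" for t
  proof -
    have "distr M borel (\<lambda>\<omega>. ?u \<bullet> block_vec (\<epsilon> t \<omega>) (\<epsilon>S t \<omega>))
        = normal_law (?u \<bullet> 0) (?u \<bullet> (?\<Sigma> *v ?u))"
      using M3_normal[of t] unfolding multivariate_normal_def by blast
    then show ?thesis unfolding e_var by (simp add: e_inner[abs_def])
  qed
  have e_indep: "indep_vars (\<lambda>_. borel) e UNIV"
    unfolding e_inner[abs_def]
    using indep_vars_compose2[OF M3_indep, of "\<lambda>_ w. ?u \<bullet> w" "\<lambda>_. borel"] by simp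
  have e_meas [measurable]: "e t \<in> borel_measurable M" for t
    using e_indep by (auto simp: indep_vars_def)
  note e_mom = normal_law_moments[OF e_meas e_law \<sigma>e2_nonneg]

  \<comment> \<open>Measurability and boundedness in probability of the series\<close>
  have y_meas [measurable]: "y t \<in> borel_measurable M"
    and y_int: "integrable M (\<lambda>\<omega>. \<bar>y t \<omega>\<bar>\<^sup>2)" for t
    using stationary_y by (auto simp: stationary_def)
  have yS_meas [measurable]: "yS t \<in> borel_measurable M"
    and yS_int: "integrable M (\<lambda>\<omega>. (norm (yS t \<omega>))\<^sup>2)" for t
    using stationary_yS by (auto simp: stationary_def)
  note [measurable] = covariates est_measurable(2,4-6)

  obtain C where C: "\<And>t. t \<ge> 1 \<Longrightarrow> expectation (\<lambda>\<omega>. (y t \<omega>) ^ 4) \<le> C"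
    using Max_bigo_1_bounded[OF moments_y(2)] by blast
  have y_bdd: "expectation (\<lambda>\<omega>. \<bar>y t \<omega>\<bar>\<^sup>2) \<le> 1 + C" if "t \<ge> 1" for t
    using second_moment_bound[OF moments_y(1)[OF that] _ C[OF that]] y_int[of t] by simp
  obtain C' where C': "\<And>t. t \<ge> 1 \<Longrightarrow> expectation (\<lambda>\<omega>. (norm (yS t \<omega>)) ^ 4) \<le> C'"
    using Max_bigo_1_bounded[OF moments_yS(2)] by blast
  have yS_bdd: "expectation (\<lambda>\<omega>. (norm (yS t \<omega>))\<^sup>2) \<le> 1 + C'" if "t \<ge> 1" for t
    using second_moment_bound[OF moments_yS(1)[OF that] yS_int C'[OF that]] .
  note y_op = bounded_in_prob_moments[of "\<lambda>t \<omega>. \<bar>y t \<omega>\<bar>", OF y_int y_bdd]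
  note yS_op = bounded_in_prob_moments[of "\<lambda>t \<omega>. norm (yS t \<omega>)", OF yS_int yS_bdd]
  note e_op = bounded_in_prob_moments(1)[of e \<sigma>e2, OF e_mom(1) eq_refl[OF e_mom(3)]]

  define D where "D \<omega> = filtered q2 A (\<lambda>t. yS t \<omega>)" for \<omega>
  have D_meas [measurable]: "(\<lambda>\<omega>. D \<omega> t) \<in> borel_measurable M" for t
    unfolding D_def by (rule measurable_filtered) auto
  have Dhat_meas [measurable]: "(\<lambda>\<omega>. Dhat T \<omega> t) \<in> borel_measurable M" for T t
    unfolding Dhat_eq by (rule measurable_filtered) (use est_measurable(1) in auto)
  \<comment> \<open>\<open>D\<close> is a fixed finite combination of lags of \<open>yS\<close>, so
    the moment bounds control it at future times as well.\<close>
  have D_op: "bounded_in_prob M (\<lambda>p. norm (D (snd p) (int (fst p) + k)))" for k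
  proof (rule bounded_in_prob_mono)
    show "bounded_in_prob M (\<lambda>p. norm (yS (int (fst p) + k) (snd p))
        + (\<Sum>l=1..q2. norm (A l) * norm (yS (int (fst p) + (k - int l)) (snd p))))"
      by (intro bounded_in_prob_add bounded_in_prob_sum bounded_in_prob_cmult yS_op(1))
    have "norm (D \<omega> t) \<le> norm (yS t \<omega>) + (\<Sum>l=1..q2. norm (A l) * norm (yS (t - int l) \<omega>))" for t \<omega>
      unfolding D_def filtered_def
      by (intro norm_triangle_ineq4[THEN order_trans] add_left_mono sum_norm_le norm_matrix_vector_mult_le)
    then show "\<forall>\<^sub>F T in sequentially. \<forall>\<omega>\<in>space M.
        \<bar>norm (D (snd (T, \<omega>)) (int (fst (T, \<omega>)) + k))\<bar> \<le> \<bar>norm (yS (int (fst (T, \<omega>)) + k) (snd (T, \<omega>)))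
        + (\<Sum>l=1..q2. norm (A l) * norm (yS (int (fst (T, \<omega>)) + (k - int l)) (snd (T, \<omega>))))\<bar>"
      by (intro always_eventually allI ballI) (auto simp: algebra_simps intro: order_trans[OF _ abs_ge_self])
  qed

  \<comment> \<open>By (M2), \<open>D\<close> is \<open>B *v x + \<epsilon>S\<close>; the covariate
    part of \<open>\<gamma> \<bullet> D\<close> is compensated by \<delta>, the noise part by
    \<open>e\<close>.\<close>
  have model: "y t \<omega> = (\<Sum>l=1..q1. a l * y (t - int l) \<omega>) + z t \<omega> \<bullet> \<theta> + x t \<omega> \<bullet> \<delta>
      + \<gamma> \<bullet> D \<omega> t + e t \<omega>" if \<omega>: "\<omega> \<in> space M" for t \<omega>
  proof -
    have "D \<omega> t = B *v x t \<omega> + \<epsilon>S t \<omega>"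
      using M2[OF \<omega>, of t] by (simp add: D_def filtered_def algebra_simps)
    moreover have "x t \<omega> \<bullet> (Finite_Cartesian_Product.transpose B *v \<gamma>) = \<gamma> \<bullet> (B *v x t \<omega>)"
      using dot_lmul_matrix[of \<gamma> B "x t \<omega>"]
      by (simp add: transpose_matrix_vector inner_commute)
    ultimately show ?thesis
      using M1[OF \<omega>, of t]
      by (simp add: \<delta>_eq e_def inner_diff_right inner_add_right)
  qed

  \<comment> \<open>Residuals and the vanishing of their error bound\<close>
  define res where "res T \<omega> = residual q1 (\<lambda>t. y t \<omega>) (\<lambda>t. z t \<omega>) (\<lambda>t. x t \<omega>) (Dhat T \<omega>)
      (ahat T \<omega>, \<theta>hat T \<omega>, \<delta>hat T \<omega>, \<gamma>hat T \<omega>)" for T \<omega>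
  have res_meas [measurable]: "(\<lambda>\<omega>. res T \<omega> t) \<in> borel_measurable M" for T t
    unfolding res_def residual_def prod.case
    by (intro borel_measurable_diff borel_measurable_sum borel_measurable_times borel_measurable_inner
        y_meas covariates est_measurable Dhat_meas) auto

  have a_lim: "((\<lambda>p. \<bar>ahat (fst p) (snd p) l - a l\<bar>) \<longlongrightarrow> 0) (whp M)" if l: "l \<in> {1..q1}" for l
  proof (rule Lim_null_comparison)
    show "((\<lambda>p. L2_set (\<lambda>l. ahat (fst p) (snd p) l - a l) {1..q1}) \<longlongrightarrow> 0) (whp M)"
    proof (rule bigO_prob_inverse_tendsto_0)
      show "(\<lambda>\<omega>. L2_set (\<lambda>l. ahat T \<omega> l - a l) {1..q1}) \<in> borel_measurable M" for T
        unfolding L2_set_def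
        by (intro borel_measurable_sqrt[THEN measurable_compose_rev] borel_measurable_sum
            borel_measurable_power borel_measurable_diff est_measurable borel_measurable_const)
    qed (use consistent_E2(1) rate in \<open>auto simp: consistent_coeffs_def\<close>)
    show "eventually (\<lambda>p. norm \<bar>ahat (fst p) (snd p) l - a l\<bar>
        \<le> L2_set (\<lambda>l. ahat (fst p) (snd p) l - a l) {1..q1}) (whp M)"
      using member_le_L2_set[OF _ l, of "\<lambda>l. \<bar>ahat _ _ l - a l\<bar>"]
      by (intro always_eventually) (simp add: L2_set_def)
  qed
  note lims = consistent_E2(2-4)[unfolded consistent_def] consistent_E1(1)[unfolded consistent_def]
  have \<gamma>_lim: "((\<lambda>p. norm (\<gamma>hat (fst p) (snd p) - \<gamma>)) \<longlongrightarrow> 0) (whp M)"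
    by (rule bigO_prob_inverse_tendsto_0[OF _ lims(3) rate]) measurable
  have A_lim: "((\<lambda>p. norm (Ahat (fst p) (snd p) l - A l)) \<longlongrightarrow> 0) (whp M)" if "l \<in> {1..q2}" for l
  proof (rule bigO_prob_inverse_tendsto_0[OF _ lims(4)[OF that] rate])
    show "(\<lambda>\<omega>. norm (Ahat T \<omega> l - A l)) \<in> borel_measurable M" for T
      using est_measurable(1)[OF that, of T] by measurable
  qed
  have \<gamma>A_lim: "((\<lambda>p. norm (\<gamma>hat (fst p) (snd p)) * norm (Ahat (fst p) (snd p) l - A l)) \<longlongrightarrow> 0) (whp M)"
    if "l \<in> {1..q2}" for l
  proof -
    have "((\<lambda>p. norm (\<gamma>hat (fst p) (snd p)) * norm (Ahat (fst p) (snd p) l - A l)) \<longlongrightarrow> norm \<gamma> * 0) (whp M)"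
      using \<gamma>_lim A_lim[OF that] by (intro tendsto_mult tendsto_norm) (simp_all add: LIM_zero_iff tendsto_norm_zero_iff)
    then show ?thesis by simp
  qed

  \<comment> \<open>The right side of \<open>residual_error_bound\<close>, with the sizes of the
    regressors left as arguments so that sample averages and single future values can both be
    inserted.\<close>
  define bnd where "bnd T \<omega> sy sz sx sD sS = (\<Sum>l=1..q1. \<bar>ahat T \<omega> l - a l\<bar> * sy l)
      + norm (\<theta>hat T \<omega> - \<theta>) * sz + norm (\<delta>hat T \<omega> - \<delta>) * sx + norm (\<gamma>hat T \<omega> - \<gamma>) * sD
      + (\<Sum>l=1..q2. (norm (\<gamma>hat T \<omega>) * norm (Ahat T \<omega> l - A l)) * sS l)"
    for T \<omega> and sy sS :: "nat \<Rightarrow> real" and sz sx sD :: real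
  have bnd_lim: "((\<lambda>p. bnd (fst p) (snd p) (\<lambda>l. sy l p) (sz p) (sx p) (sD p) (\<lambda>l. sS l p)) \<longlongrightarrow> 0) (whp M)"
    if sy: "\<And>l. l \<in> {1..q1} \<Longrightarrow> bounded_in_prob M (sy l)"
      and sz: "((\<lambda>p. sz p / \<zeta> (fst p)) \<longlongrightarrow> 0) (whp M)"
      and sx: "((\<lambda>p. sx p / \<zeta> (fst p)) \<longlongrightarrow> 0) (whp M)"
      and sD: "((\<lambda>p. sD p / \<zeta> (fst p)) \<longlongrightarrow> 0) (whp M)"
      and sS: "\<And>l. l \<in> {1..q2} \<Longrightarrow> bounded_in_prob M (sS l)"
    for sy sS :: "nat \<Rightarrow> nat \<times> 'w \<Rightarrow> real" and sz sx sD :: "nat \<times> 'w \<Rightarrow> real"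
    unfolding bnd_def
  proof (intro tendsto_add_zero tendsto_null_sum)
    fix l assume "l \<in> {1..q1}"
    then show "((\<lambda>p. \<bar>ahat (fst p) (snd p) l - a l\<bar> * sy l p) \<longlongrightarrow> 0) (whp M)"
      by (subst mult.commute) (intro bounded_in_prob_mult_tendsto_0 sy a_lim)
  next
    fix l assume "l \<in> {1..q2}"
    then show "((\<lambda>p. (norm (\<gamma>hat (fst p) (snd p)) * norm (Ahat (fst p) (snd p) l - A l)) * sS l p) \<longlongrightarrow> 0) (whp M)"
      by (subst mult.commute) (intro bounded_in_prob_mult_tendsto_0 sS \<gamma>A_lim)
  next
    show "((\<lambda>p. norm (\<theta>hat (fst p) (snd p) - \<theta>) * sz p) \<longlongrightarrow> 0) (whp M)"
      by (rule bigO_prob_inverse_mult_tendsto_0[OF _ lims(1) rate sz]) measurable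
    show "((\<lambda>p. norm (\<delta>hat (fst p) (snd p) - \<delta>) * sx p) \<longlongrightarrow> 0) (whp M)"
      by (rule bigO_prob_inverse_mult_tendsto_0[OF _ lims(2) rate sx]) measurable
    show "((\<lambda>p. norm (\<gamma>hat (fst p) (snd p) - \<gamma>) * sD p) \<longlongrightarrow> 0) (whp M)"
      by (rule bigO_prob_inverse_mult_tendsto_0[OF _ lims(3) rate sD]) measurable
  qed

  \<comment> \<open>Consistency of the variance estimator\<close>
  have "((\<lambda>p. rms q1 (fst p) (res (fst p) (snd p)) - rms q1 (fst p) (\<lambda>t. e t (snd p))) \<longlongrightarrow> 0) (whp M)"
  proof (rule Lim_null_comparison_whp)
    show "((\<lambda>p. bnd (fst p) (snd p) (\<lambda>l. rms q1 (fst p) (\<lambda>t. \<bar>y (t - int l) (snd p)\<bar>))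
        (rms q1 (fst p) (\<lambda>t. norm (z t (snd p)))) (rms q1 (fst p) (\<lambda>t. norm (x t (snd p))))
        (rms q1 (fst p) (\<lambda>t. norm (D (snd p) t)))
        (\<lambda>l. rms q1 (fst p) (\<lambda>t. norm (yS (t - int l) (snd p))))) \<longlongrightarrow> 0) (whp M)"
    proof (rule bnd_lim)
      show "((\<lambda>p. rms q1 (fst p) (\<lambda>t. norm (D (snd p) t)) / \<zeta> (fst p)) \<longlongrightarrow> 0) (whp M)"
        by (rule rms_smallo_of_lambda_max[OF D_meas _ rate]) (use eig_D in \<open>simp add: D_def\<close>)
    qed (use orders in \<open>auto intro!: y_op(2) yS_op(2) rms_smallo_of_lambda_max covariates eig_z eig_x rate\<close>)
    show "\<forall>\<^sub>F T in sequentially. \<forall>\<omega>\<in>space M. norm (rms q1 T (res T \<omega>) - rms q1 T (\<lambda>t. e t \<omega>))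
        \<le> bnd T \<omega> (\<lambda>l. rms q1 T (\<lambda>t. \<bar>y (t - int l) \<omega>\<bar>)) (rms q1 T (\<lambda>t. norm (z t \<omega>)))
            (rms q1 T (\<lambda>t. norm (x t \<omega>))) (rms q1 T (\<lambda>t. norm (D \<omega> t)))
            (\<lambda>l. rms q1 T (\<lambda>t. norm (yS (t - int l) \<omega>)))"
      using eventually_gt_at_top[of q1]
    proof (eventually_elim, intro ballI)
      fix T \<omega> assume T: "q1 < T" and \<omega>: "\<omega> \<in> space M"
      note rms_diff_le[OF T, of "res T \<omega>" "\<lambda>t. e t \<omega>"]
      also have "rms q1 T (\<lambda>t. res T \<omega> t - e t \<omega>)
          \<le> bnd T \<omega> (\<lambda>l. rms q1 T (\<lambda>t. \<bar>y (t - int l) \<omega>\<bar>)) (rms q1 T (\<lambda>t. norm (z t \<omega>)))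
            (rms q1 T (\<lambda>t. norm (x t \<omega>))) (rms q1 T (\<lambda>t. norm (D \<omega> t)))
            (\<lambda>l. rms q1 T (\<lambda>t. norm (yS (t - int l) \<omega>)))"
        unfolding bnd_def res_def Dhat_eq D_def
        by (rule rms_residual_error_bound[OF T model[OF \<omega>, unfolded D_def]])
      finally show "norm (rms q1 T (res T \<omega>) - rms q1 T (\<lambda>t. e t \<omega>))
          \<le> bnd T \<omega> (\<lambda>l. rms q1 T (\<lambda>t. \<bar>y (t - int l) \<omega>\<bar>)) (rms q1 T (\<lambda>t. norm (z t \<omega>)))
            (rms q1 T (\<lambda>t. norm (x t \<omega>))) (rms q1 T (\<lambda>t. norm (D \<omega> t)))
            (\<lambda>l. rms q1 T (\<lambda>t. norm (yS (t - int l) \<omega>)))"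
        by (simp only: real_norm_def)
    qed
  qed
  moreover have "((\<lambda>p. rms q1 (fst p) (\<lambda>t. e t (snd p))) \<longlongrightarrow> sqrt \<sigma>e2) (whp M)"
  proof (rule Lim_transform_eventually)
    show "((\<lambda>p. sqrt ((\<Sum>t\<in>{int q1 + 1..int (fst p)}. (e t (snd p))\<^sup>2) / (real (fst p) - real q1)))
        \<longlongrightarrow> sqrt \<sigma>e2) (whp M)"
      by (intro tendsto_real_sqrt weak_law_normal_squares e_indep e_law \<sigma>e2_nonneg)
    show "eventually (\<lambda>p. sqrt ((\<Sum>t\<in>{int q1 + 1..int (fst p)}. (e t (snd p))\<^sup>2) / (real (fst p) - real q1))
        = rms q1 (fst p) (\<lambda>t. e t (snd p))) (whp M)"
      by (simp add: rms_def L2_set_def real_sqrt_divide)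
  qed
  ultimately have rms_lim: "((\<lambda>p. rms q1 (fst p) (res (fst p) (snd p))) \<longlongrightarrow> sqrt \<sigma>e2) (whp M)"
    by (rule Lim_transform[rotated])
  have var_lim: "((\<lambda>p. \<sigma>e2hat (fst p) (snd p)) \<longlongrightarrow> \<sigma>e2) (whp M)"
  proof (rule Lim_transform_eventually)
    show "((\<lambda>p. (rms q1 (fst p) (res (fst p) (snd p)))\<^sup>2) \<longlongrightarrow> \<sigma>e2) (whp M)"
      using tendsto_power[OF rms_lim, of 2] \<sigma>e2_nonneg by simp
    show "eventually (\<lambda>p. (rms q1 (fst p) (res (fst p) (snd p)))\<^sup>2 = \<sigma>e2hat (fst p) (snd p)) (whp M)"
    proof (rule eventually_whpI)
      show "\<forall>\<^sub>F T in sequentially. \<forall>\<omega>\<in>space M.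
          (rms q1 (fst (T, \<omega>)) (res (fst (T, \<omega>)) (snd (T, \<omega>))))\<^sup>2 = \<sigma>e2hat (fst (T, \<omega>)) (snd (T, \<omega>))"
        using eventually_gt_at_top[of q1]
        by eventually_elim (simp add: rms_sq \<sigma>e2hat_eq variance_hat_def res_def)
    qed
  qed
  have var_meas [measurable]: "\<sigma>e2hat T \<in> borel_measurable M" for T
  proof -
    have "\<sigma>e2hat T = (\<lambda>\<omega>. 1 / (real T - real q1) * (\<Sum>t\<in>{int q1 + 1..int T}. (res T \<omega> t)\<^sup>2))"
      by (simp add: fun_eq_iff \<sigma>e2hat_eq variance_hat_def res_def)
    then show ?thesis by simp
  qed
  have consistent_var: "tendsto_in_prob M \<sigma>e2hat \<sigma>e2"
    using var_meas var_lim by (rule tendsto_in_probI)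

  \<comment> \<open>Coverage of the Box--Jenkins interval\<close>
  have coverage: "ereal (1 - \<alpha>) \<le> liminf (\<lambda>T. ereal (prob {\<omega> \<in> space M. y (int (T + h)) \<omega> \<in>
      BJ_interval q1 (ahat T \<omega>) (sqrt (\<sigma>e2hat T \<omega>)) \<alpha> h (yhat T \<omega> (int (T + h)))}))"
    if pos: "\<sigma>e2 > 0" and h: "h \<ge> 1"
      and zx: "\<And>j. j \<in> {1..h} \<Longrightarrow> smallo_prob M (\<lambda>T \<omega>. norm (z (int (T + j)) \<omega>)) \<zeta>"
        "\<And>j. j \<in> {1..h} \<Longrightarrow> smallo_prob M (\<lambda>T \<omega>. norm (x (int (T + j)) \<omega>)) \<zeta>"
    for h
  proof -
    have res_lim: "((\<lambda>p. res (fst p) (snd p) (int (fst p + j)) - e (int (fst p + j)) (snd p)) \<longlongrightarrow> 0) (whp M)"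
      if j: "j \<in> {1..h}" for j
    proof (rule Lim_null_comparison_whp)
      have inv: "(\<lambda>T. 1 / \<zeta> T) \<longlonglongrightarrow> 0"
        using rate by (intro tendsto_divide_0[OF tendsto_const]) (rule filterlim_at_top_imp_at_infinity)
      have sz: "((\<lambda>p. norm (z (int (fst p + j)) (snd p)) / \<zeta> (fst p)) \<longlongrightarrow> 0) (whp M)"
        by (rule smallo_probD[OF _ zx(1)[OF j] \<zeta>0]) measurable
      have sx: "((\<lambda>p. norm (x (int (fst p + j)) (snd p)) / \<zeta> (fst p)) \<longlongrightarrow> 0) (whp M)"
        by (rule smallo_probD[OF _ zx(2)[OF j] \<zeta>0]) measurable
      have sD: "((\<lambda>p. norm (D (snd p) (int (fst p + j))) / \<zeta> (fst p)) \<longlongrightarrow> 0) (whp M)"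
        using bounded_in_prob_mult_tendsto_0[OF D_op[of "int j"] tendsto_whp_deterministic[OF inv]] by simp
      have sy: "bounded_in_prob M (\<lambda>p. \<bar>y (int (fst p + j) - int l) (snd p)\<bar>)" for l
        using y_op(1)[of "int j - int l"] by (simp add: algebra_simps)
      have sS: "bounded_in_prob M (\<lambda>p. norm (yS (int (fst p + j) - int l) (snd p)))" for l
        using yS_op(1)[of "int j - int l"] by (simp add: algebra_simps)
      show "((\<lambda>p. bnd (fst p) (snd p) (\<lambda>l. \<bar>y (int (fst p + j) - int l) (snd p)\<bar>)
          (norm (z (int (fst p + j)) (snd p))) (norm (x (int (fst p + j)) (snd p)))
          (norm (D (snd p) (int (fst p + j))))
          (\<lambda>l. norm (yS (int (fst p + j) - int l) (snd p)))) \<longlongrightarrow> 0) (whp M)"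
        by (rule bnd_lim[OF sy sz sx sD sS])
      show "\<forall>\<^sub>F T in sequentially. \<forall>\<omega>\<in>space M. norm (res T \<omega> (int (T + j)) - e (int (T + j)) \<omega>)
          \<le> bnd T \<omega> (\<lambda>l. \<bar>y (int (T + j) - int l) \<omega>\<bar>) (norm (z (int (T + j)) \<omega>))
              (norm (x (int (T + j)) \<omega>)) (norm (D \<omega> (int (T + j))))
              (\<lambda>l. norm (yS (int (T + j) - int l) \<omega>))"
      proof (intro always_eventually allI ballI)
        fix T \<omega> assume \<omega>: "\<omega> \<in> space M"
        show "norm (res T \<omega> (int (T + j)) - e (int (T + j)) \<omega>)
          \<le> bnd T \<omega> (\<lambda>l. \<bar>y (int (T + j) - int l) \<omega>\<bar>) (norm (z (int (T + j)) \<omega>))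
              (norm (x (int (T + j)) \<omega>)) (norm (D \<omega> (int (T + j))))
              (\<lambda>l. norm (yS (int (T + j) - int l) \<omega>))"
          unfolding real_norm_def bnd_def res_def Dhat_eq D_def
          by (rule residual_error_bound[OF model[OF \<omega>, unfolded D_def]])
      qed
    qed

    define \<psi> where "\<psi> r = (companion q1 a ^\<^sub>m r) $$ (0, 0)" for r
    define \<psi>h where "\<psi>h T \<omega> r = (companion q1 (ahat T \<omega>) ^\<^sub>m r) $$ (0, 0)" for T \<omega> r
    have \<psi>h_meas [measurable]: "(\<lambda>\<omega>. \<psi>h T \<omega> r) \<in> borel_measurable M" for T r
      unfolding \<psi>h_def using q1 by (intro measurable_companion_pow est_measurable) auto
    have \<psi>_lim: "((\<lambda>p. \<psi>h (fst p) (snd p) r) \<longlongrightarrow> \<psi> r) (whp M)" for r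
      unfolding \<psi>h_def \<psi>_def
    proof (rule tendsto_companion_pow)
      show "((\<lambda>p. ahat (fst p) (snd p) l) \<longlongrightarrow> a l) (whp M)" if "l \<in> {1..q1}" for l
        using a_lim[OF that] by (simp add: LIM_zero_iff tendsto_rabs_zero_iff)
    qed (use q1 in simp)
    \<comment> \<open>The latest innovation always enters with weight 1, so the limiting variance is
      positive whatever the coefficients are.\<close>
    have \<psi>0: "\<psi> 0 = 1" unfolding \<psi>_def using q1 by (simp add: companion_pow_row_0 del: pow_mat.simps)

    define U where "U T \<omega> = (\<Sum>r<h. \<psi> r * e (int T + int h - int r) \<omega>)" for T \<omega>
    define V where "V T \<omega> = (\<Sum>r<h. \<psi>h T \<omega> r * res T \<omega> (int T + int h - int r)
        - \<psi> r * e (int T + int h - int r) \<omega>)" for T \<omega>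
    define W where "W T \<omega> = \<bar>normal_quantile (\<alpha> / 2)\<bar> * sqrt (\<sigma>e2hat T \<omega>)
        * sqrt (\<Sum>r<h. (\<psi>h T \<omega> r)\<^sup>2)" for T \<omega>
    define s where "s = sqrt \<sigma>e2 * sqrt (\<Sum>r<h. (\<psi> r)\<^sup>2)"
    have "(\<Sum>r<h. (\<psi> r)\<^sup>2) > 0"
      using h \<psi>0 by (intro sum_pos2[of _ 0]) auto
    then have s: "s > 0" using pos by (simp add: s_def)

    have U_normal: "distributed M lborel (U T) (normal_density 0 s)" for T
    proof -
      let ?c = "\<lambda>t. \<psi> (nat (int T + int h - t))"
      let ?J = "{int T + 1..int T + int h}"
      \<comment> \<open>\<open>sum_indep_normal\<close> requires positive standard deviations, so
        the times with weight zero are dropped; \<open>T + h\<close> always remains.\<close>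
      let ?I = "{t \<in> ?J. ?c t \<noteq> 0}"
      have reindex: "(\<Sum>r<h. g r) = (\<Sum>t\<in>?J. g (nat (int T + int h - t)))" for g :: "nat \<Rightarrow> real"
        by (rule sum.reindex_bij_witness[of _ "\<lambda>t. nat (int T + int h - t)" "\<lambda>r. int T + int h - int r"]) auto
      have "distributed M lborel (\<lambda>\<omega>. \<Sum>t\<in>?I. ?c t * e t \<omega>)
          (normal_density (\<Sum>t\<in>?I. 0) (sqrt (\<Sum>t\<in>?I. (\<bar>?c t\<bar> * sqrt \<sigma>e2)\<^sup>2)))"
      proof (rule sum_indep_normal)
        have "int T + int h \<in> ?I" using \<psi>0 h by simp
        then show "?I \<noteq> {}" by blast
        show "indep_vars (\<lambda>i. borel) (\<lambda>t \<omega>. ?c t * e t \<omega>) ?I"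
          by (rule indep_vars_compose2[OF indep_vars_subset[OF e_indep]]) auto
        show "0 < \<bar>?c t\<bar> * sqrt \<sigma>e2" if "t \<in> ?I" for t using that pos by simp
        show "distributed M lborel (\<lambda>\<omega>. ?c t * e t \<omega>) (normal_density 0 (\<bar>?c t\<bar> * sqrt \<sigma>e2))"
          if "t \<in> ?I" for t
          using normal_density_affine[OF normal_law_distributed[OF e_meas e_law pos], of "?c t" 0 t]
            that pos by simp
        show "finite ?I" by (rule finite_subset[of _ ?J]) auto
      qed
      also have "(\<lambda>\<omega>. \<Sum>t\<in>?I. ?c t * e t \<omega>) = U T"
      proof
        fix \<omega>
        have "(\<Sum>t\<in>?I. ?c t * e t \<omega>) = (\<Sum>t\<in>?J. ?c t * e t \<omega>)"
          by (rule sum.mono_neutral_left) auto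
        also have "\<dots> = U T \<omega>" unfolding U_def reindex by (rule sum.cong) auto
        finally show "(\<Sum>t\<in>?I. ?c t * e t \<omega>) = U T \<omega>" .
      qed
      also have "(\<Sum>t\<in>?I. (\<bar>?c t\<bar> * sqrt \<sigma>e2)\<^sup>2) = (\<Sum>t\<in>?J. \<sigma>e2 * (?c t)\<^sup>2)"
        using pos by (intro sum.mono_neutral_cong_left) (auto simp: power_mult_distrib)
      also have "\<dots> = \<sigma>e2 * (\<Sum>r<h. (\<psi> r)\<^sup>2)" unfolding reindex by (simp add: sum_distrib_left)
      also have "sqrt \<dots> = s" by (simp add: s_def real_sqrt_mult)
      finally show ?thesis by simp
    qed

    have V_lim: "((\<lambda>p. V (fst p) (snd p)) \<longlongrightarrow> 0) (whp M)"
      unfolding V_def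
    proof (rule tendsto_null_sum)
      fix r assume "r \<in> {..<h}"
      then have j: "h - r \<in> {1..h}" and t: "int T + int h - int r = int (T + (h - r))" for T by auto
      \<comment> \<open>The split is \<open>\<psi>h * res - \<psi> * e = \<psi>h * (res - e) + e *
        (\<psi>h - \<psi>)\<close>. In the second product \<open>e\<close> moves with
        \<open>T\<close> and has no limit, but it is bounded in probability.\<close>
      have "((\<lambda>p. \<psi>h (fst p) (snd p) r * (res (fst p) (snd p) (int (fst p + (h - r))) - e (int (fst p + (h - r))) (snd p))
          + e (int (fst p + (h - r))) (snd p) * (\<psi>h (fst p) (snd p) r - \<psi> r)) \<longlongrightarrow> \<psi> r * 0 + 0) (whp M)"
        using e_op[of "int (h - r)"] \<psi>_lim[of r]
        by (intro tendsto_add tendsto_mult \<psi>_lim res_lim[OF j] bounded_in_prob_mult_tendsto_0)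
          (simp_all add: LIM_zero_iff)
      then show "((\<lambda>p. \<psi>h (fst p) (snd p) r * res (fst p) (snd p) (int (fst p) + int h - int r)
          - \<psi> r * e (int (fst p) + int h - int r) (snd p)) \<longlongrightarrow> 0) (whp M)"
        unfolding t by (simp add: algebra_simps)
    qed
    have W_lim: "((\<lambda>p. W (fst p) (snd p)) \<longlongrightarrow> \<bar>normal_quantile (\<alpha> / 2)\<bar> * s) (whp M)"
      unfolding W_def s_def mult.assoc
      by (intro tendsto_mult tendsto_const tendsto_real_sqrt var_lim tendsto_sum tendsto_power \<psi>_lim)
    have event: "{\<omega> \<in> space M. y (int (T + h)) \<omega> \<in>
        BJ_interval q1 (ahat T \<omega>) (sqrt (\<sigma>e2hat T \<omega>)) \<alpha> h (yhat T \<omega> (int (T + h)))}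
        = {\<omega> \<in> space M. \<bar>U T \<omega> + V T \<omega>\<bar> \<le> W T \<omega>}" for T
    proof -
      have "y (int (T + h)) \<omega> - yhat T \<omega> (int (T + h)) = U T \<omega> + V T \<omega>" for \<omega>
        using forecast_error[OF q1, of "\<lambda>t. y t \<omega>" T h]
        by (simp add: yhat_eq U_def V_def \<psi>h_def res_def sum_subtractf)
      \<comment> \<open>This uses \<open>h \<ge> 1\<close>: with truncated subtraction the left side
        would be \<open>{0}\<close> at \<open>h = 0\<close>.\<close>
      moreover have "{0..h - 1} = {..<h}" using h by auto
      ultimately show ?thesis
        by (auto simp: BJ_interval_def Let_def W_def \<psi>h_def abs_le_iff algebra_simps)
    qed
    have "{\<omega> \<in> space M. \<bar>U T \<omega> + V T \<omega>\<bar> \<le> W T \<omega>} \<in> events" for T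
      unfolding U_def V_def W_def by measurable
    from normal_interval_coverage[OF U_normal s V_lim W_lim level(1) this]
    show ?thesis unfolding event .
  qed

  show ?thesis using consistent_var coverage by blast
qed

end
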